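(* Let $n\ge2$, $0<m<n$, and let $f:\mathbb{R}^n\to\mathbb{R}^m$ be smooth with Jacobian $J(x)$ of full rank $m$ for every $x\in\mathbb{R}^n$. Let $T$, $N$, $R$, $N'_\perp$, $N'_\|$ be as in the context. Fix $x_0,v_0\in\mathbb{R}^n$ and a time interval $[0,t_{\rm end}]$. Let $(x(t),v(t))$ be the solution of $$\frac{d}{dt}x=T(x)v,\qquad \frac{d}{dt}v=\Bigl(N'_\|(x)\bigl[(T(x)-N(x))v\bigr]-N'_\perp(x)\bigl[(T(x)-N(x))v\bigr]\Bigr)v$$ with $x(0)=x_0$, $v(0)=v_0$, and write $v_\|(t)=T(x(t))v(t)$, $v_\perp(t)=N(x(t))v(t)$. For $\delta>0$ let $(x_k,v_k)$ be the iterates generated from $(x_0,v_0)$ by $$x_{k+1/2}=x_k+(\delta/2)v_k,\qquad v_{k+1}=R(x_{k+1/2})v_k,\qquad x_{k+1}=x_{k+1/2}+(\delta/2)v_{k+1}.$$ Then, as $\delta\to0$, $$\max_{k\delta\le t_{\rm end}}\|x_k-x(k\delta)\|=\mathcal{O}(\delta^2)$$ and $$\max_{k\delta\le t_{\rm end}}\bigl\|v_k-\bigl(v_\|(k\delta)+(-1)^kv_\perp(k\delta)\bigr)\bigr\|=\mathcal{O}(\delta^2).$$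
   Context: $\|\cdot\|$ is the Euclidean norm, and the maxima run over integers $k\ge0$ with $k\delta\le t_{\rm end}$. $J(x)$ is the $m\times n$ Jacobian of $f$ at $x$; $J(x)^+=J(x)^\top(J(x)J(x)^\top)^{-1}$; $N(x)=J(x)^+J(x)$ is the orthogonal projection onto the orthogonal complement of $\ker J(x)$; $T(x)=I-N(x)$ is the orthogonal projection onto $\ker J(x)$; $R(x)=I-2N(x)$. $H(x):\mathbb{R}^n\times\mathbb{R}^n\to\mathbb{R}^m$ is the second derivative of $f$ at $x$ (the $i$-th component of $H(x)[u,w]$ is $u^\top\nabla^2f_i(x)w$), and $H(x)[w,\cdot]$ is the $m\times n$ matrix of the linear map $z\mapsto H(x)[w,z]$. For $x,w\in\mathbb{R}^n$ define the $n\times n$ matrices $$N'_\perp(x)[w]=J(x)^+H(x)[w,\cdot]\,T(x),\qquad N'_\|(x)[w]=\bigl(N'_\perp(x)[w]\bigr)^\top.$$ (By a result of Golub and Pereyra, the derivative $N'(x)[w]$ of $N$ at $x$ in the direction $w$ equals $N'_\perp(x)[w]+N'_\|(x)[w]$.) The constants implicit in the $\mathcal{O}$ notation depend only on $f$, $x_0$, $v_0$ and $t_{\rm end}$. *)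

theory Defs
  imports "HOL-Analysis.Analysis"
begin

text \<open>\<open>C\<^sup>k\<close> is expressed through iterated directional derivatives; the total differentiability
  demanded at every level makes this the usual notion in finite dimensions.\<close>

fun Ck :: "nat \<Rightarrow> ('a::euclidean_space \<Rightarrow> 'b::real_normed_vector) \<Rightarrow> bool" where
  "Ck 0 f \<longleftrightarrow> continuous_on UNIV f"
| "Ck (Suc k) f \<longleftrightarrow>
     (\<forall>x. f differentiable (at x)) \<and> (\<forall>w. Ck k (\<lambda>x. frechet_derivative f (at x) w))"

definition smooth :: "('a::euclidean_space \<Rightarrow> 'b::real_normed_vector) \<Rightarrow> bool" where
  "smooth f \<longleftrightarrow> (\<forall>k. Ck k f)"

definition Jac_pinv :: "(real^'n \<Rightarrow> real^'m) \<Rightarrow> real^'n \<Rightarrow> real^'m^'n" where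
  "Jac_pinv f x = (let J = jacobian f (at x) in transpose J ** matrix_inv (J ** transpose J))"

definition proj_normal :: "(real^'n \<Rightarrow> real^'m) \<Rightarrow> real^'n \<Rightarrow> real^'n^'n" where
  "proj_normal f x = Jac_pinv f x ** jacobian f (at x)"

definition proj_tangent :: "(real^'n \<Rightarrow> real^'m) \<Rightarrow> real^'n \<Rightarrow> real^'n^'n" where
  "proj_tangent f x = mat 1 - proj_normal f x"

definition reflector :: "(real^'n \<Rightarrow> real^'m) \<Rightarrow> real^'n \<Rightarrow> real^'n^'n" where
  "reflector f x = mat 1 - 2 *\<^sub>R proj_normal f x"

text \<open>The second derivative as a bilinear map, \<open>D(y \<mapsto> Df(y) w)(x) u\<close>.\<close>

definition second_deriv :: "(real^'n \<Rightarrow> real^'m) \<Rightarrow> real^'n \<Rightarrow> real^'n \<Rightarrow> real^'n \<Rightarrow> real^'m" where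
  "second_deriv f x u w =
     frechet_derivative (\<lambda>y. frechet_derivative f (at y) w) (at x) u"

definition dN_perp :: "(real^'n \<Rightarrow> real^'m) \<Rightarrow> real^'n \<Rightarrow> real^'n \<Rightarrow> real^'n^'n" where
  "dN_perp f x w =
     Jac_pinv f x ** matrix (\<lambda>z. second_deriv f x w z) ** proj_tangent f x"

definition dN_par :: "(real^'n \<Rightarrow> real^'m) \<Rightarrow> real^'n \<Rightarrow> real^'n \<Rightarrow> real^'n^'n" where
  "dN_par f x w = transpose (dN_perp f x w)"

definition solves_limit_ode ::
  "(real^'n \<Rightarrow> real^'m) \<Rightarrow> real^'n \<Rightarrow> real^'n \<Rightarrow> real \<Rightarrow>
     (real \<Rightarrow> real^'n) \<Rightarrow> (real \<Rightarrow> real^'n) \<Rightarrow> bool" where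
  "solves_limit_ode f x0 v0 tend x v \<longleftrightarrow>
     x 0 = x0 \<and> v 0 = v0 \<and>
     (\<forall>t\<in>{0..tend}.
        (x has_vector_derivative proj_tangent f (x t) *v v t) (at t within {0..tend}) \<and>
        (v has_vector_derivative
           (let w = (proj_tangent f (x t) - proj_normal f (x t)) *v v t
            in (dN_par f (x t) w - dN_perp f (x t) w) *v v t)) (at t within {0..tend}))"

definition bounce_step ::
  "(real^'n \<Rightarrow> real^'m) \<Rightarrow> real \<Rightarrow> (real^'n) \<times> (real^'n) \<Rightarrow> (real^'n) \<times> (real^'n)" where
  "bounce_step f \<delta> = (\<lambda>(x, v).
     let xh = x + (\<delta> / 2) *\<^sub>R v;
         v' = reflector f xh *v v
     in (xh + (\<delta> / 2) *\<^sub>R v', v'))"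

definition bounce_iter ::
  "(real^'n \<Rightarrow> real^'m) \<Rightarrow> real \<Rightarrow> real^'n \<Rightarrow> real^'n \<Rightarrow> nat \<Rightarrow> (real^'n) \<times> (real^'n)" where
  "bounce_iter f \<delta> x0 v0 k = (bounce_step f \<delta> ^^ k) (x0, v0)"

text \<open>The index sets below are finite and nonempty only for \<open>\<delta> > 0\<close> and \<open>tend \<ge> 0\<close>, the only case used.\<close>

definition pos_error ::
  "(real^'n \<Rightarrow> real^'m) \<Rightarrow> real^'n \<Rightarrow> real^'n \<Rightarrow> real \<Rightarrow> (real \<Rightarrow> real^'n) \<Rightarrow> real \<Rightarrow> real" where
  "pos_error f x0 v0 tend x \<delta> =
     (MAX k\<in>{k. real k * \<delta> \<le> tend}. norm (fst (bounce_iter f \<delta> x0 v0 k) - x (real k * \<delta>)))"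

definition vel_error ::
  "(real^'n \<Rightarrow> real^'m) \<Rightarrow> real^'n \<Rightarrow> real^'n \<Rightarrow> real \<Rightarrow>
     (real \<Rightarrow> real^'n) \<Rightarrow> (real \<Rightarrow> real^'n) \<Rightarrow> real \<Rightarrow> real" where
  "vel_error f x0 v0 tend x v \<delta> =
     (MAX k\<in>{k. real k * \<delta> \<le> tend}.
        norm (snd (bounce_iter f \<delta> x0 v0 k) -
          (let t = real k * \<delta>
           in proj_tangent f (x t) *v v t + (-1) ^ k *\<^sub>R (proj_normal f (x t) *v v t))))"

end

theory Submission
  imports Defs
begin

text \<open>
  Undoing the sign flip of the normal velocity, put \<open>w\<^sub>k = v\<^sub>k\<close> for even \<open>k\<close>,
  \<open>w\<^sub>k = R(x\<^sub>k) v\<^sub>k\<close> for odd \<open>k\<close>, and \<open>z\<^sub>k = (x\<^sub>k, w\<^sub>k)\<close>.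
  The bounce step with step size \<open>-\<delta>\<close> inverts the one with step size \<open>\<delta>\<close>, so both
  neighbours of an odd state are bounce steps from that state, and the velocity they need is the value at
  \<open>\<plusminus>\<delta>\<close> of \<open>h(s) = R(x\<^sub>k + (s/2) v\<^sub>k) v\<^sub>k\<close>. Odd powers survive in the difference, which gives the
  leapfrog relation \<open>z\<^sub>k\<^sub>+\<^sub>1 - z\<^sub>k\<^sub>-\<^sub>1 = 2\<delta> F(z\<^sub>k) + O(\<delta>\<^sup>3)\<close> and the one-step relation
  \<open>z\<^sub>k - z\<^sub>k\<^sub>-\<^sub>1 = \<delta> F(z\<^sub>k) + O(\<delta>\<^sup>2)\<close>, with \<open>F\<close> the right-hand side of the limit equation in the
  form \<open>F(x, v) = (T(x) v, - N'(x)[R(x) v] R(x) v)\<close>. The solution satisfies the same two relations, and a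
  discrete Gronwall argument over the even indices compares the two. Reflections are isometries and
  \<open>N'\<^sub>\<parallel> - N'\<^sub>\<perp>\<close> is skew, so speeds are conserved and all
  constants can be taken on one compact set that does not depend on the solution.
\<close>

subsection \<open>Calculus of smooth functions\<close>

lemma differentiable_has_frechet:
  "f differentiable at x \<Longrightarrow> (f has_derivative frechet_derivative f (at x)) (at x)"
  by (simp add: frechet_derivative_works)

lemma Ck_Suc_imp_Ck: "Ck (Suc k) f \<Longrightarrow> Ck k f"
proof (induction k arbitrary: f)
  case 0
  then show ?case
    by (auto intro!: differentiable_imp_continuous_on simp: differentiable_on_def)
next
  case (Suc k)
  then show ?case by simp
qed

lemma Ck_const [simp]: "Ck k (\<lambda>x. c)"
  by (induction k arbitrary: c) (simp_all)

text \<open>The induction generalises over \<open>f\<close>, since a directional derivative of the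
  composite is \<open>L\<close> applied to that of \<open>f\<close>: the same shape, one order
  lower. The composition, sum, product and reciprocal lemmas below repeat this pattern with their
  own differentiation rules.\<close>

lemma Ck_bounded_linear_compose:
  assumes "bounded_linear L" "Ck k f"
  shows "Ck k (\<lambda>x. L (f x))"
  using assms(2)
proof (induction k arbitrary: f)
  case 0
  then show ?case using bounded_linear.continuous_on[OF assms(1)] by simp
next
  case (Suc k)
  have D: "((\<lambda>x. L (f x)) has_derivative (\<lambda>w. L (frechet_derivative f (at x) w))) (at x)" for x
    using Suc.prems by (intro bounded_linear.has_derivative[OF assms(1)] differentiable_has_frechet) simp
  show ?case
    using Suc D by (auto simp: differentiable_def simp flip: frechet_derivative_at[OF D])
qed

lemma Ck_compose_bounded_linear:
  fixes L :: "'a::euclidean_space \<Rightarrow> 'b::euclidean_space"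
  assumes "bounded_linear L" "Ck k f"
  shows "Ck k (\<lambda>x. f (L x))"
  using assms(2)
proof (induction k arbitrary: f)
  case 0
  then have "continuous_on UNIV f" by simp
  then show ?case
    using continuous_on_compose2[of UNIV f UNIV L] linear_continuous_on[OF assms(1)] by simp
next
  case (Suc k)
  have D: "((\<lambda>x. f (L x)) has_derivative (\<lambda>w. frechet_derivative f (at (L x)) (L w))) (at x)" for x
    using Suc.prems
    by (intro has_derivative_compose[OF bounded_linear_imp_has_derivative[OF assms(1)]]
        differentiable_has_frechet) simp
  show ?case
    using Suc D by (auto simp: differentiable_def simp flip: frechet_derivative_at[OF D])
qed

lemma Ck_id: "Ck k (\<lambda>x. x)"
proof (cases k)
  case (Suc j)
  have D: "((\<lambda>x. x) has_derivative (\<lambda>w. w)) (at x)" for x :: 'a by (rule has_derivative_ident)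
  show ?thesis
    using Suc by (auto simp: differentiable_def simp flip: frechet_derivative_at[OF D])
qed (simp add: continuous_on_id)

lemma Ck_add:
  assumes "Ck k f" "Ck k g"
  shows "Ck k (\<lambda>x. f x + g x)"
  using assms
proof (induction k arbitrary: f g)
  case (Suc k)
  have D: "((\<lambda>x. f x + g x) has_derivative
      (\<lambda>w. frechet_derivative f (at x) w + frechet_derivative g (at x) w)) (at x)" for x
    using Suc.prems by (intro has_derivative_add differentiable_has_frechet) simp_all
  show ?case
    using Suc D by (auto simp: differentiable_def simp flip: frechet_derivative_at[OF D])
qed (simp add: continuous_on_add)

text \<open>The product rule leaves one factor undifferentiated; \<open>Ck_Suc_imp_Ck\<close> lowers
  its order so that the induction hypothesis applies to each summand.\<close>

lemma Ck_bilinear: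
  assumes B: "bounded_bilinear B" and "Ck k f" "Ck k g"
  shows "Ck k (\<lambda>x. B (f x) (g x))"
  using assms(2,3)
proof (induction k arbitrary: f g)
  case 0
  then show ?case by (simp add: bounded_bilinear.continuous_on[OF B])
next
  case (Suc k)
  have D: "((\<lambda>x. B (f x) (g x)) has_derivative
      (\<lambda>w. B (f x) (frechet_derivative g (at x) w) + B (frechet_derivative f (at x) w) (g x))) (at x)"
    for x
    using Suc.prems by (intro bounded_bilinear.FDERIV[OF B] differentiable_has_frechet) simp_all
  show ?case
    using Suc D
    by (auto simp: differentiable_def Ck_Suc_imp_Ck simp flip: frechet_derivative_at[OF D]
        intro!: Ck_add)
qed

lemma Ck_inverse:
  fixes f :: "'a::euclidean_space \<Rightarrow> real"
  assumes "Ck k f" "\<And>x. f x \<noteq> 0"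
  shows "Ck k (\<lambda>x. inverse (f x))"
  using assms
proof (induction k arbitrary: f)
  case 0
  then show ?case by (auto intro!: continuous_on_inverse)
next
  case (Suc k)
  have D: "((\<lambda>x. inverse (f x)) has_derivative
      (\<lambda>w. - (inverse (f x) * frechet_derivative f (at x) w * inverse (f x)))) (at x)" for x
    using Suc.prems by (intro Deriv.has_derivative_inverse differentiable_has_frechet) simp_all
  \<comment> \<open>The derivative of the reciprocal contains the reciprocal itself, so its
    regularity at the lower order \<open>k\<close> is secured first.\<close>
  have "Ck k (\<lambda>x. inverse (f x))"
    using Suc.IH[of f] Suc.prems Ck_Suc_imp_Ck by blast
  then have "Ck k (\<lambda>x. - (inverse (f x) * frechet_derivative f (at x) w * inverse (f x)))" for w
    using Suc.prems
    by (intro Ck_bounded_linear_compose[OF bounded_linear_minus[OF bounded_linear_ident]]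
        Ck_bilinear[OF bounded_bilinear_mult]) simp_all
  then show ?case
    using D by (auto simp: differentiable_def simp flip: frechet_derivative_at[OF D])
qed

lemma smooth_const [simp]: "smooth (\<lambda>x. c)"
  and smooth_id [simp]: "smooth (\<lambda>x. x)"
  by (simp_all add: smooth_def Ck_id)

lemma smooth_bounded_linear_compose: "bounded_linear L \<Longrightarrow> smooth f \<Longrightarrow> smooth (\<lambda>x. L (f x))"
  by (simp add: smooth_def Ck_bounded_linear_compose)

lemma smooth_compose_bounded_linear:
  fixes L :: "'a::euclidean_space \<Rightarrow> 'b::euclidean_space"
  shows "bounded_linear L \<Longrightarrow> smooth f \<Longrightarrow> smooth (\<lambda>x. f (L x))"
  by (simp add: smooth_def Ck_compose_bounded_linear)

lemma smooth_add: "smooth f \<Longrightarrow> smooth g \<Longrightarrow> smooth (\<lambda>x. f x + g x)"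
  by (simp add: smooth_def Ck_add)

lemma smooth_minus: "smooth f \<Longrightarrow> smooth (\<lambda>x. - f x)"
  by (rule smooth_bounded_linear_compose[OF bounded_linear_minus[OF bounded_linear_ident]])

lemma smooth_diff: "smooth f \<Longrightarrow> smooth g \<Longrightarrow> smooth (\<lambda>x. f x - g x)"
  using smooth_add[of f "\<lambda>x. - g x"] smooth_minus[of g] by simp

lemma smooth_bilinear:
  "bounded_bilinear B \<Longrightarrow> smooth f \<Longrightarrow> smooth g \<Longrightarrow> smooth (\<lambda>x. B (f x) (g x))"
  by (simp add: smooth_def Ck_bilinear)

lemma smooth_inverse:
  fixes f :: "'a::euclidean_space \<Rightarrow> real"
  shows "smooth f \<Longrightarrow> (\<And>x. f x \<noteq> 0) \<Longrightarrow> smooth (\<lambda>x. inverse (f x))"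
  by (simp add: smooth_def Ck_inverse)

lemma smooth_sum: "(\<And>i. i \<in> A \<Longrightarrow> smooth (f i)) \<Longrightarrow> smooth (\<lambda>x. \<Sum>i\<in>A. f i x)"
  by (induction A rule: infinite_finite_induct) (auto intro: smooth_add)

lemma smooth_prod:
  fixes f :: "'i \<Rightarrow> 'a::euclidean_space \<Rightarrow> real"
  shows "(\<And>i. i \<in> A \<Longrightarrow> smooth (f i)) \<Longrightarrow> smooth (\<lambda>x. \<Prod>i\<in>A. f i x)"
  by (induction A rule: infinite_finite_induct)
     (auto intro: smooth_bilinear[OF bounded_bilinear_mult])

lemma smooth_differentiable: "smooth f \<Longrightarrow> f differentiable at x"
  unfolding smooth_def using Ck.simps(2) by blast

lemma smooth_has_derivative:
  "smooth f \<Longrightarrow> (f has_derivative frechet_derivative f (at x)) (at x)"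
  by (intro differentiable_has_frechet smooth_differentiable)

lemma smooth_frechet_derivative: "smooth f \<Longrightarrow> smooth (\<lambda>x. frechet_derivative f (at x) w)"
  unfolding smooth_def using Ck.simps(2) by blast

lemma smooth_continuous_on: "smooth f \<Longrightarrow> continuous_on S f"
  unfolding smooth_def using Ck.simps(1) continuous_on_subset by blast

lemma smooth_Pair:
  assumes "smooth f" "smooth g"
  shows "smooth (\<lambda>x. (f x, g x))"
proof -
  have "smooth (\<lambda>x. (f x, 0) + (0, g x))"
    using assms by (intro smooth_add smooth_bounded_linear_compose[of "\<lambda>u. (u, 0)"]
        smooth_bounded_linear_compose[of "\<lambda>u. (0, u)"] bounded_linear_Pair
        bounded_linear_ident bounded_linear_zero)
  then show ?thesis by simp
qed

lemma smooth_componentwise: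
  fixes f :: "'a::euclidean_space \<Rightarrow> 'b::euclidean_space^'n"
  assumes "\<And>i. smooth (\<lambda>x. f x $ i)"
  shows "smooth f"
proof -
  have "bounded_linear (axis i :: 'b \<Rightarrow> 'b^'n)" for i
    unfolding linear_conv_bounded_linear[symmetric]
    by (auto intro!: linearI simp: vec_eq_iff axis_def)
  then have "smooth (\<lambda>x. \<Sum>i\<in>UNIV. axis i (f x $ i))"
    using assms by (intro smooth_sum smooth_bounded_linear_compose[of "axis _"])
  moreover have "(\<Sum>i\<in>UNIV. axis i (y $ i)) = y" for y :: "'b^'n"
    by (simp add: vec_eq_iff axis_def)
  ultimately show ?thesis by simp
qed

lemma smooth_vec_nth:
  fixes f :: "'a::euclidean_space \<Rightarrow> 'b::real_normed_vector^'n"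
  shows "smooth f \<Longrightarrow> smooth (\<lambda>x. f x $ i)"
  by (rule smooth_bounded_linear_compose[OF bounded_linear_vec_nth])

section \<open>Smoothness of matrix operations, including inversion\<close>

lemma bounded_bilinear_matrix_vector_mult:
  "bounded_bilinear ((*v) :: real^'n^'m \<Rightarrow> real^'n \<Rightarrow> real^'m)"
  unfolding bilinear_conv_bounded_bilinear[symmetric] bilinear_def
  by (auto intro!: linearI simp: matrix_vector_mult_def vec_eq_iff sum.distrib sum_distrib_left
      algebra_simps)

lemma bounded_bilinear_matrix_mult:
  "bounded_bilinear ((**) :: real^'n^'m \<Rightarrow> real^'k^'n \<Rightarrow> real^'k^'m)"
  unfolding bilinear_conv_bounded_bilinear[symmetric] bilinear_def
  by (auto intro!: linearI simp: matrix_add_ldistrib matrix_matrix_mult_def vec_eq_iff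
      sum.distrib sum_distrib_left algebra_simps)

lemma bounded_linear_transpose: "bounded_linear (transpose :: real^'n^'m \<Rightarrow> real^'m^'n)"
  unfolding linear_conv_bounded_linear[symmetric]
  by (auto intro!: linearI simp: transpose_def vec_eq_iff)

lemma smooth_det:
  fixes A :: "'a::euclidean_space \<Rightarrow> real^'n^'n"
  assumes "\<And>i j. smooth (\<lambda>x. A x $ i $ j)"
  shows "smooth (\<lambda>x. det (A x))"
  unfolding det_def
  using assms by (intro smooth_sum smooth_bilinear[OF bounded_bilinear_mult] smooth_prod smooth_const)

lemma matrix_inv_right: "invertible A \<Longrightarrow> A ** matrix_inv A = mat 1"
  unfolding invertible_def matrix_inv_def by (metis (mono_tags, lifting) someI_ex)

text \<open>Cramer's rule with right-hand side \<open>axis j 1\<close>, whose solution is column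
  \<open>j\<close> of the inverse.\<close>

lemma matrix_inv_component:
  fixes A :: "real^'n^'n"
  assumes "invertible A"
  shows "matrix_inv A $ i $ j =
    det (\<chi> k l. if l = i then axis j 1 $ k else A $ k $ l) / det A"
proof -
  have "A *v (matrix_inv A *v axis j 1) = axis j 1"
    using assms by (simp add: matrix_vector_mul_assoc matrix_inv_right)
  then have "matrix_inv A *v axis j 1 =
      (\<chi> i. det (\<chi> k l. if l = i then axis j 1 $ k else A $ k $ l) / det A)"
    using assms invertible_det_nz cramer by blast
  then show ?thesis
    by (simp add: matrix_vector_mul_component vec_eq_iff inner_axis column_def matrix_vector_mult_basis)
qed

text \<open>By Cramer's rule each entry is a polynomial in the entries of \<open>A x\<close> times
  the reciprocal of the nowhere vanishing \<open>det (A x)\<close>.\<close>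

lemma smooth_matrix_inv:
  fixes A :: "'a::euclidean_space \<Rightarrow> real^'n^'n"
  assumes "smooth A" "\<And>x. invertible (A x)"
  shows "smooth (\<lambda>x. matrix_inv (A x))"
proof (intro smooth_componentwise)
  fix i j
  have A: "smooth (\<lambda>x. A x $ k $ l)" for k l
    using assms(1) by (intro smooth_vec_nth)
  have "smooth (\<lambda>x. if l = i then axis j 1 $ k else A x $ k $ l)" for k l
    by (cases "l = i") (simp_all add: A)
  moreover have "det (A x) \<noteq> 0" for x
    using assms(2) invertible_det_nz by blast
  ultimately have "smooth (\<lambda>x. det (\<chi> k l. if l = i then axis j 1 $ k else A x $ k $ l) *
      inverse (det (A x)))"
    using A by (intro smooth_bilinear[OF bounded_bilinear_mult] smooth_inverse smooth_det) simp_all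
  then show "smooth (\<lambda>x. matrix_inv (A x) $ i $ j)"
    using assms(2) by (simp add: matrix_inv_component divide_inverse)
qed

subsection \<open>Taylor expansion along integral curves\<close>

lemma frechet_derivative_expand:
  fixes Q :: "'a::euclidean_space \<Rightarrow> 'b::real_normed_vector"
  assumes "Q differentiable at z"
  shows "frechet_derivative Q (at z) w = (\<Sum>b\<in>Basis. (w \<bullet> b) *\<^sub>R frechet_derivative Q (at z) b)"
proof -
  interpret linear "frechet_derivative Q (at z)"
    using assms by (rule linear_frechet_derivative)
  have "frechet_derivative Q (at z) w = frechet_derivative Q (at z) (\<Sum>b\<in>Basis. (w \<bullet> b) *\<^sub>R b)"
    by (simp add: euclidean_representation)
  then show ?thesis by (simp add: sum scaleR)
qed

text \<open>\<open>Ck\<close> only controls derivatives in a fixed direction. Expanding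
  \<open>q z\<close> in the basis reduces a direction that varies with the point to finitely many
  fixed ones.\<close>

lemma smooth_frechet_derivative_apply:
  fixes L :: "'a::euclidean_space \<Rightarrow> 'c::euclidean_space"
  assumes "smooth Q" "bounded_linear L" "smooth q"
  shows "smooth (\<lambda>z. frechet_derivative Q (at (L z)) (q z))"
proof -
  have "smooth (\<lambda>z. \<Sum>b\<in>Basis. (q z \<bullet> b) *\<^sub>R frechet_derivative Q (at (L z)) b)"
    using assms
    by (intro smooth_sum smooth_bilinear[OF bounded_bilinear_scaleR]
        smooth_bounded_linear_compose[OF bounded_linear_inner_left]
        smooth_compose_bounded_linear[OF assms(2)] smooth_frechet_derivative)
  then show ?thesis
    by (simp flip: frechet_derivative_expand[OF smooth_differentiable[OF assms(1)]])
qed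

section \<open>Uniform bounds and Lipschitz constants on compact sets\<close>

lemma smooth_bounded_on_compact:
  assumes "smooth Q" "compact K"
  obtains M where "M \<ge> 0" "\<And>z. z \<in> K \<Longrightarrow> norm (Q z) \<le> M"
proof -
  have "bounded (Q ` K)"
    using assms by (intro compact_imp_bounded compact_continuous_image smooth_continuous_on)
  then obtain M where "M > 0" "\<forall>y\<in>Q ` K. norm y \<le> M"
    using bounded_pos by blast
  then show ?thesis using that[of M] by auto
qed

text \<open>Mean value inequality: the operator norm of the derivative is at most the sum of the
  norms of its values on the basis, and each of these is bounded on \<open>K\<close>.\<close>

lemma smooth_lipschitz_on_compact:
  fixes Q :: "'a::euclidean_space \<Rightarrow> 'b::real_normed_vector"
  assumes "smooth Q" "compact K" "convex K"
  obtains L where "L \<ge> 0" "\<And>y z. y \<in> K \<Longrightarrow> z \<in> K \<Longrightarrow> norm (Q y - Q z) \<le> L * norm (y - z)"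
proof -
  have "\<exists>M\<ge>0. \<forall>z\<in>K. norm (frechet_derivative Q (at z) b) \<le> M" for b
    using smooth_bounded_on_compact[OF smooth_frechet_derivative[OF assms(1)] assms(2)] by metis
  then obtain M where M: "\<And>b. M b \<ge> 0"
    "\<And>b z. z \<in> K \<Longrightarrow> norm (frechet_derivative Q (at z) b) \<le> M b"
    by metis
  have "norm (Q y - Q z) \<le> (\<Sum>b\<in>Basis. M b) * norm (y - z)" if "y \<in> K" "z \<in> K" for y z
  proof (rule differentiable_bound[OF assms(3) _ _ that(1,2)])
    fix x assume "x \<in> K"
    show "(Q has_derivative frechet_derivative Q (at x)) (at x within K)"
      using smooth_has_derivative[OF assms(1)] has_derivative_at_withinI by blast
    show "onorm (frechet_derivative Q (at x)) \<le> (\<Sum>b\<in>Basis. M b)"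
      using smooth_has_derivative[OF assms(1)] \<open>x \<in> K\<close>
      by (intro onorm_componentwise_le sum_mono M(2)) (auto dest: has_derivative_bounded_linear)
  qed
  then show ?thesis
    using that M(1) by (meson sum_nonneg)
qed

text \<open>The Lie derivative of \<open>Q\<close> along the vector field \<open>F\<close>. Its
  iterates are the successive time derivatives of \<open>Q\<close> along any integral curve of
  \<open>F\<close>.\<close>

definition lie :: "('a::euclidean_space \<Rightarrow> 'a) \<Rightarrow> ('a \<Rightarrow> 'b::real_normed_vector) \<Rightarrow> 'a \<Rightarrow> 'b" where
  "lie F Q z = frechet_derivative Q (at z) (F z)"

lemma lie_eqI: "(Q has_derivative Q') (at z) \<Longrightarrow> lie F Q z = Q' (F z)"
  unfolding lie_def using frechet_derivative_at by metis

lemma smooth_lie: "smooth F \<Longrightarrow> smooth Q \<Longrightarrow> smooth (lie F Q)"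
  unfolding lie_def by (rule smooth_frechet_derivative_apply[OF _ bounded_linear_ident])

lemma smooth_lie_funpow: "smooth F \<Longrightarrow> smooth Q \<Longrightarrow> smooth ((lie F ^^ i) Q)"
  by (induction i) (simp_all add: smooth_lie)

lemma has_vector_derivative_lie:
  assumes "smooth Q" "(z has_vector_derivative F (z t)) (at t within S)"
  shows "((\<lambda>t. Q (z t)) has_vector_derivative lie F Q (z t)) (at t within S)"
proof -
  have "((\<lambda>t. Q (z t)) has_derivative (\<lambda>h. frechet_derivative Q (at (z t)) (h *\<^sub>R F (z t)))) (at t within S)"
    using has_derivative_compose[OF assms(2)[unfolded has_vector_derivative_def]
        smooth_has_derivative[OF assms(1)]] .
  then show ?thesis
    using linear_frechet_derivative[OF smooth_differentiable[OF assms(1)], of "z t"]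
    by (simp add: has_vector_derivative_def lie_def linear_scale)
qed

text \<open>Taylor's formula with integral remainder. The kernel is bounded crudely by
  \<open>(b - a) ^ (p - 1)\<close>, as only the order in \<open>b - a\<close> matters later.\<close>

lemma taylor_bound:
  fixes D :: "nat \<Rightarrow> real \<Rightarrow> 'a::banach"
  assumes "a \<le> b" "p > 0"
    and D: "\<And>i t. i < p \<Longrightarrow> t \<in> {a..b} \<Longrightarrow> (D i has_vector_derivative D (Suc i) t) (at t within {a..b})"
    and M: "\<And>t. t \<in> {a..b} \<Longrightarrow> norm (D p t) \<le> M"
  shows "norm (D 0 b - (\<Sum>i<p. ((b - a) ^ i / fact i) *\<^sub>R D i a)) \<le> M * (b - a) ^ p"
proof -
  have M0: "0 \<le> M"
    using M[of a] \<open>a \<le> b\<close> norm_ge_zero order_trans by (metis atLeastAtMost_iff order_refl)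
  have I: "((\<lambda>t. ((b - t) ^ (p - 1) / fact (p - 1)) *\<^sub>R D p t) has_integral
      D 0 b - (\<Sum>i<p. ((b - a) ^ i / fact i) *\<^sub>R D i a)) {a..b}"
    using assms by (intro Taylor_has_integral) auto
  have "norm (((b - t) ^ (p - 1) / fact (p - 1)) *\<^sub>R D p t) \<le> (b - a) ^ (p - 1) * M"
    if "t \<in> {a..b}" for t
  proof -
    have "(b - t) ^ (p - 1) / fact (p - 1) \<le> (b - t) ^ (p - 1) / 1"
      using that by (intro divide_left_mono) auto
    also have "\<dots> \<le> (b - a) ^ (p - 1)"
      using that by (auto intro!: power_mono)
    finally have "\<bar>(b - t) ^ (p - 1) / fact (p - 1)\<bar> \<le> (b - a) ^ (p - 1)"
      using that by simp
    then have "\<bar>(b - t) ^ (p - 1) / fact (p - 1)\<bar> * norm (D p t) \<le> (b - a) ^ (p - 1) * M"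
      using M[OF that] \<open>a \<le> b\<close> by (intro mult_mono) auto
    then show ?thesis by simp
  qed
  then have "norm (D 0 b - (\<Sum>i<p. ((b - a) ^ i / fact i) *\<^sub>R D i a)) \<le> (b - a) ^ (p - 1) * M * measure lborel (cbox a b)"
    using M0 \<open>a \<le> b\<close> I by (intro has_integral_bound) (auto simp: cbox_interval)
  also have "\<dots> = M * (b - a) ^ p"
    using \<open>a \<le> b\<close> \<open>p > 0\<close> by (cases p) (auto simp: cbox_interval)
  finally show ?thesis .
qed

text \<open>Time reversal: the forward bound is applied on \<open>{-b..-a}\<close> to the family
  \<open>E\<close>, whose signs \<open>(-1) ^ i\<close> account for the reversed
  derivatives.\<close>

lemma taylor_bound_backward:
  fixes D :: "nat \<Rightarrow> real \<Rightarrow> 'a::banach"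
  assumes "a \<le> b" "p > 0"
    and D: "\<And>i t. i < p \<Longrightarrow> t \<in> {a..b} \<Longrightarrow> (D i has_vector_derivative D (Suc i) t) (at t within {a..b})"
    and M: "\<And>t. t \<in> {a..b} \<Longrightarrow> norm (D p t) \<le> M"
  shows "norm (D 0 a - (\<Sum>i<p. ((a - b) ^ i / fact i) *\<^sub>R D i b)) \<le> M * (b - a) ^ p"
proof -
  define E where "E i t = (-1) ^ i *\<^sub>R D i (- t)" for i :: nat and t
  have "(E i has_vector_derivative E (Suc i) t) (at t within {-b..-a})"
    if "i < p" "t \<in> {-b..-a}" for i t
  proof -
    have "(D i has_vector_derivative D (Suc i) (-t)) (at (-t) within uminus ` {-b..-a})"
      using D[OF that(1), of "-t"] that(2) by auto
    moreover have "(uminus has_vector_derivative -1) (at t within {-b..-a})"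
      by (auto intro!: derivative_eq_intros)
    ultimately have "((D i \<circ> uminus) has_vector_derivative (-1) *\<^sub>R D (Suc i) (-t)) (at t within {-b..-a})"
      using vector_diff_chain_within by blast
    then have "((\<lambda>t. (-1) ^ i *\<^sub>R D i (- t)) has_vector_derivative (-1) ^ i *\<^sub>R (-1) *\<^sub>R D (Suc i) (-t)) (at t within {-b..-a})"
      unfolding o_def
      by (intro bounded_linear.has_vector_derivative[OF bounded_linear_scaleR_right])
    then show ?thesis by (simp add: E_def[abs_def])
  qed
  moreover have "norm (E p t) \<le> M" if "t \<in> {-b..-a}" for t
    using M[of "-t"] that by (auto simp: E_def)
  ultimately have "norm (E 0 (-a) - (\<Sum>i<p. ((-a - -b) ^ i / fact i) *\<^sub>R E i (-b))) \<le> M * (-a - -b) ^ p"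
    using assms(1,2) by (intro taylor_bound) simp_all
  moreover have "((-a - -b) ^ i / fact i) *\<^sub>R E i (-b) = ((a - b) ^ i / fact i) *\<^sub>R D i b" for i
  proof -
    have "(-a - -b) ^ i / fact i * (-1) ^ i = ((-a - -b) * (-1)) ^ i / fact i"
      unfolding power_mult_distrib by simp
    also have "\<dots> = (a - b) ^ i / fact i"
      by simp
    finally show ?thesis by (simp only: E_def scaleR_scaleR minus_minus)
  qed
  ultimately have "norm (E 0 (-a) - (\<Sum>i<p. ((a - b) ^ i / fact i) *\<^sub>R D i b)) \<le> M * (-a - -b) ^ p"
    by (simp only:)
  then show ?thesis by (simp add: E_def)
qed

text \<open>Derivatives are taken within \<open>S\<close>, so they are one-sided at the ends of an
  interval and the notion passes to subsets. Membership in \<open>K\<close> is included so that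
  Taylor constants can be uniform over curves.\<close>

definition integral_curve :: "('a::real_normed_vector \<Rightarrow> 'a) \<Rightarrow> 'a set \<Rightarrow> real set \<Rightarrow> (real \<Rightarrow> 'a) \<Rightarrow> bool" where
  "integral_curve F K S z \<longleftrightarrow>
     (\<forall>t\<in>S. z t \<in> K \<and> (z has_vector_derivative F (z t)) (at t within S))"

lemma integral_curve_subset: "integral_curve F K S z \<Longrightarrow> R \<subseteq> S \<Longrightarrow> integral_curve F K R z"
  unfolding integral_curve_def by (meson has_vector_derivative_within_subset subsetD)

text \<open>The remainder is governed by the \<open>p\<close>-th Lie derivative evaluated on the
  curve. A bound for it on \<open>K\<close> gives one constant for all curves and all
  intervals.\<close>

lemma lie_taylor:
  fixes F :: "'a::euclidean_space \<Rightarrow> 'a" and Q :: "'a \<Rightarrow> 'b::banach"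
  assumes "smooth F" "smooth Q" "compact K" "p > 0"
  obtains C where "C \<ge> 0"
    "\<And>z a b. a \<le> b \<Longrightarrow> integral_curve F K {a..b} z \<Longrightarrow>
       norm (Q (z b) - (\<Sum>i<p. ((b - a) ^ i / fact i) *\<^sub>R (lie F ^^ i) Q (z a))) \<le> C * (b - a) ^ p"
    "\<And>z a b. a \<le> b \<Longrightarrow> integral_curve F K {a..b} z \<Longrightarrow>
       norm (Q (z a) - (\<Sum>i<p. ((a - b) ^ i / fact i) *\<^sub>R (lie F ^^ i) Q (z b))) \<le> C * (b - a) ^ p"
proof -
  obtain M where M: "M \<ge> 0" "\<And>z. z \<in> K \<Longrightarrow> norm ((lie F ^^ p) Q z) \<le> M"
    using smooth_bounded_on_compact[OF smooth_lie_funpow[OF assms(1,2)] assms(3)] by blast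
  have D: "((\<lambda>t. (lie F ^^ i) Q (z t)) has_vector_derivative (lie F ^^ Suc i) Q (z t)) (at t within {a..b})"
    if "integral_curve F K {a..b} z" "t \<in> {a..b}" for z a b t i
    using that has_vector_derivative_lie[OF smooth_lie_funpow[OF assms(1,2)]]
    by (auto simp: integral_curve_def)
  show ?thesis
  proof (rule that[OF M(1)])
    fix z and a b :: real
    assume *: "a \<le> b" "integral_curve F K {a..b} z"
    show "norm (Q (z b) - (\<Sum>i<p. ((b - a) ^ i / fact i) *\<^sub>R (lie F ^^ i) Q (z a))) \<le> M * (b - a) ^ p"
      using taylor_bound[where D = "\<lambda>i t. (lie F ^^ i) Q (z t)", OF *(1) assms(4) D[OF *(2)]] M *
      by (auto simp: integral_curve_def)
    show "norm (Q (z a) - (\<Sum>i<p. ((a - b) ^ i / fact i) *\<^sub>R (lie F ^^ i) Q (z b))) \<le> M * (b - a) ^ p"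
      using taylor_bound_backward[where D = "\<lambda>i t. (lie F ^^ i) Q (z t)", OF *(1) assms(4) D[OF *(2)]] M *
      by (auto simp: integral_curve_def)
  qed
qed

lemma norm_diff_add_le:
  fixes u w :: "'a::real_normed_vector"
  assumes "norm u \<le> c" "norm w \<le> d"
  shows "norm (u - w) \<le> c + d" "norm (u + w) \<le> c + d"
  using assms norm_triangle_ineq4[of u w] norm_triangle_ineq[of u w] by linarith+

lemma symmetric_expansion:
  fixes F :: "'a::euclidean_space \<Rightarrow> 'a" and Q :: "'a \<Rightarrow> 'b::banach"
  assumes "smooth F" "smooth Q" "compact K"
  obtains C where "C \<ge> 0"
    "\<And>z t d. d \<ge> 0 \<Longrightarrow> integral_curve F K {t-d..t} z \<Longrightarrow>
       norm (Q (z t) - Q (z (t - d))) \<le> C * d"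
    "\<And>z t d. d \<ge> 0 \<Longrightarrow> integral_curve F K {t-d..t} z \<Longrightarrow>
       norm (Q (z t) - Q (z (t - d)) - d *\<^sub>R lie F Q (z t)) \<le> C * d ^ 2"
    "\<And>z t d. d \<ge> 0 \<Longrightarrow> integral_curve F K {t-d..t+d} z \<Longrightarrow>
       norm (Q (z (t + d)) - Q (z (t - d)) - (2 * d) *\<^sub>R lie F Q (z t)) \<le> C * d ^ 3"
    "\<And>z t d. d \<ge> 0 \<Longrightarrow> integral_curve F K {t-d..t+d} z \<Longrightarrow>
       norm (Q (z (t + d)) + Q (z (t - d)) - 2 *\<^sub>R Q (z t)) \<le> C * d ^ 2"
proof -
  obtain C where C: "C \<ge> 0"
    "\<And>z a b. a \<le> b \<Longrightarrow> integral_curve F K {a..b} z \<Longrightarrow>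
       norm (Q (z b) - (\<Sum>i<3. ((b - a) ^ i / fact i) *\<^sub>R (lie F ^^ i) Q (z a))) \<le> C * (b - a) ^ 3"
    "\<And>z a b. a \<le> b \<Longrightarrow> integral_curve F K {a..b} z \<Longrightarrow>
       norm (Q (z a) - (\<Sum>i<3. ((a - b) ^ i / fact i) *\<^sub>R (lie F ^^ i) Q (z b))) \<le> C * (b - a) ^ 3"
    using lie_taylor[OF assms, of 3] by auto
  obtain D where D: "D \<ge> 0"
    "\<And>z a b. a \<le> b \<Longrightarrow> integral_curve F K {a..b} z \<Longrightarrow>
       norm (Q (z b) - (\<Sum>i<2. ((b - a) ^ i / fact i) *\<^sub>R (lie F ^^ i) Q (z a))) \<le> D * (b - a) ^ 2"
    "\<And>z a b. a \<le> b \<Longrightarrow> integral_curve F K {a..b} z \<Longrightarrow>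
       norm (Q (z a) - (\<Sum>i<2. ((a - b) ^ i / fact i) *\<^sub>R (lie F ^^ i) Q (z b))) \<le> D * (b - a) ^ 2"
    using lie_taylor[OF assms, of 2] by auto
  obtain E where E: "E \<ge> 0"
    "\<And>z a b. a \<le> b \<Longrightarrow> integral_curve F K {a..b} z \<Longrightarrow> norm (Q (z b) - Q (z a)) \<le> E * (b - a)"
  proof (rule lie_taylor[OF assms zero_less_one])
    fix E assume "E \<ge> 0" and
      "\<And>z a b. a \<le> b \<Longrightarrow> integral_curve F K {a..b} z \<Longrightarrow>
       norm (Q (z b) - (\<Sum>i<1. ((b - a) ^ i / fact i) *\<^sub>R (lie F ^^ i) Q (z a))) \<le> E * (b - a) ^ 1"
    then show thesis by (intro that[of E]) simp_all
  qed
  show ?thesis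
  \<comment> \<open>One constant dominates all four estimates: \<open>E\<close> and \<open>D\<close>
    serve the one-sided ones, and each two-sided one adds two remainders, whence
    \<open>2 * C\<close> and \<open>2 * D\<close>.\<close>
  proof (rule that[of "2 * C + 2 * D + E"])
    show "0 \<le> 2 * C + 2 * D + E" using C D E by simp
    fix z and t d :: real
    assume d: "d \<ge> 0"
    {
      assume z: "integral_curve F K {t-d..t} z"
      have "norm (Q (z t) - Q (z (t - d))) \<le> E * d"
        using E(2)[OF _ z] d by simp
      also have "\<dots> \<le> (2 * C + 2 * D + E) * d"
        using C D d by (simp add: mult_right_mono)
      finally show "norm (Q (z t) - Q (z (t - d))) \<le> (2 * C + 2 * D + E) * d" .
      have "norm (Q (z (t - d)) - (\<Sum>i<2. ((t - d - t) ^ i / fact i) *\<^sub>R (lie F ^^ i) Q (z t)))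
        \<le> D * (t - (t - d)) ^ 2"
        using D(3)[OF _ z] d by simp
      also have "\<dots> \<le> (2 * C + 2 * D + E) * d\<^sup>2"
        using C D E by (simp add: mult_right_mono)
      finally show "norm (Q (z t) - Q (z (t - d)) - d *\<^sub>R lie F Q (z t)) \<le> (2 * C + 2 * D + E) * d\<^sup>2"
        by (simp add: numeral_eq_Suc norm_minus_commute algebra_simps)
    }
    assume z: "integral_curve F K {t-d..t+d} z"
    have zl: "integral_curve F K {t-d..t} z" and zr: "integral_curve F K {t..t+d} z"
      using d by (auto intro!: integral_curve_subset[OF z])
    \<comment> \<open>Subtracting the forward and backward expansions cancels the terms of degree 0
      and 2.\<close>
    have "norm (Q (z (t + d)) - (\<Sum>i<3. (d ^ i / fact i) *\<^sub>R (lie F ^^ i) Q (z t)) -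
        (Q (z (t - d)) - (\<Sum>i<3. ((- d) ^ i / fact i) *\<^sub>R (lie F ^^ i) Q (z t))))
        \<le> C * d ^ 3 + C * d ^ 3"
      using norm_diff_add_le(1)[OF C(2)[OF _ zr] C(3)[OF _ zl]] d by simp
    also have "\<dots> \<le> (2 * C + 2 * D + E) * d ^ 3"
      using D E d by (simp add: algebra_simps)
    finally show "norm (Q (z (t + d)) - Q (z (t - d)) - (2 * d) *\<^sub>R lie F Q (z t)) \<le> (2 * C + 2 * D + E) * d ^ 3"
      by (simp add: numeral_eq_Suc algebra_simps scaleR_2[symmetric] flip: scaleR_add_left)
    \<comment> \<open>Adding the shorter expansions cancels the linear term.\<close>
    have "norm (Q (z (t + d)) - (\<Sum>i<2. (d ^ i / fact i) *\<^sub>R (lie F ^^ i) Q (z t)) +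
        (Q (z (t - d)) - (\<Sum>i<2. ((- d) ^ i / fact i) *\<^sub>R (lie F ^^ i) Q (z t))))
        \<le> D * d ^ 2 + D * d ^ 2"
      using norm_diff_add_le(2)[OF D(2)[OF _ zr] D(3)[OF _ zl]] d by simp
    also have "\<dots> \<le> (2 * C + 2 * D + E) * d ^ 2"
      using C E d by (simp add: algebra_simps)
    finally show "norm (Q (z (t + d)) + Q (z (t - d)) - 2 *\<^sub>R Q (z t)) \<le> (2 * C + 2 * D + E) * d\<^sup>2"
      by (simp add: numeral_eq_Suc algebra_simps scaleR_2[symmetric] flip: scaleR_add_left)
  qed
qed

subsection \<open>The normal projection and its derivative\<close>

locale full_rank_map =
  fixes f :: "real^'n \<Rightarrow> real^'m"
  assumes smooth_f: "smooth f"
    and full_rank: "\<And>x. rank (jacobian f (at x)) = CARD('m)"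
begin

abbreviation "J x \<equiv> jacobian f (at x)"
abbreviation "N \<equiv> proj_normal f"
abbreviation "R \<equiv> reflector f"

lemma smooth_jacobian: "smooth (\<lambda>x. J x)"
  by (intro smooth_componentwise)
     (simp add: jacobian_def matrix_def smooth_vec_nth smooth_frechet_derivative smooth_f)

text \<open>If the Gram matrix annihilates \<open>y\<close>, then the transposed Jacobian applied to
  \<open>y\<close> has squared norm 0; full row rank makes that transpose injective.\<close>

lemma gram_invertible: "invertible (J x ** transpose (J x))"
proof -
  have inj: "inj ((*v) (transpose (J x)))"
    using full_rank[of x] by (simp add: rank_transpose flip: full_rank_injective)
  have "y = 0" if "(J x ** transpose (J x)) *v y = 0" for y
  proof -
    have "(transpose (J x) *v y) \<bullet> (transpose (J x) *v y) = y \<bullet> ((J x ** transpose (J x)) *v y)"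
      by (simp add: dot_lmul_matrix flip: matrix_vector_mul_assoc)
    then have "transpose (J x) *v y = transpose (J x) *v 0"
      using that by simp
    then show ?thesis using inj by (simp only: inj_eq)
  qed
  then have "inj ((*v) (J x ** transpose (J x)))"
    by (simp add: linear_injective_0)
  then show ?thesis
    by (simp add: invertible_left_inverse matrix_left_invertible_injective)
qed

lemma smooth_proj_normal: "smooth N"
  unfolding proj_normal_def[abs_def] Jac_pinv_def Let_def
  by (intro smooth_bilinear[OF bounded_bilinear_matrix_mult] smooth_matrix_inv gram_invertible
      smooth_bounded_linear_compose[OF bounded_linear_transpose] smooth_jacobian)

lemma jacobian_proj_normal: "J x ** N x = J x"
  by (simp add: proj_normal_def Jac_pinv_def Let_def matrix_mul_assoc
      matrix_inv_right[OF gram_invertible])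

lemma proj_normal_idem: "N x ** N x = N x"
  using jacobian_proj_normal[of x]
  by (simp add: proj_normal_def[of f x] flip: matrix_mul_assoc)

text \<open>The Gram matrix \<open>G\<close> is symmetric, so the transpose of its right inverse is
  a left inverse and the two coincide.\<close>

lemma transpose_proj_normal: "transpose (N x) = N x"
proof -
  define G where "G = J x ** transpose (J x)"
  have "transpose (matrix_inv G) ** G = transpose (G ** matrix_inv G)"
    by (simp add: matrix_transpose_mul G_def)
  then have "transpose (matrix_inv G) = matrix_inv G"
    using matrix_inv_right[OF gram_invertible[of x]]
    by (metis G_def matrix_mul_assoc matrix_mul_lid matrix_mul_rid transpose_mat)
  then show ?thesis
    by (simp add: proj_normal_def Jac_pinv_def Let_def matrix_transpose_mul matrix_mul_assoc
        flip: G_def)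
qed

lemma inner_proj_normal: "(N x *v u) \<bullet> v = u \<bullet> (N x *v v)"
  by (metis dot_lmul_matrix transpose_matrix_vector transpose_proj_normal)

lemma reflector_mult: "R x *v v = v - 2 *\<^sub>R (N x *v v)"
  by (simp add: reflector_def matrix_vector_mult_diff_rdistrib scaleR_matrix_vector_assoc)

lemma proj_tangent_mult: "proj_tangent f x *v v = v - N x *v v"
  by (simp add: proj_tangent_def matrix_vector_mult_diff_rdistrib)

lemma proj_tangent_eq: "proj_tangent f x *v v = (1/2) *\<^sub>R (v + R x *v v)"
  by (simp add: reflector_mult proj_tangent_mult vec_eq_iff)

lemma proj_normal_mult_idem: "N x *v (N x *v v) = N x *v v"
  by (simp add: matrix_vector_mul_assoc proj_normal_idem)

lemma reflector_involution: "R x *v (R x *v v) = v"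
  by (simp add: reflector_mult matrix_vector_mult_diff_distrib proj_normal_mult_idem
      matrix_vector_mult_scaleR algebra_simps)

text \<open>In the expanded square the cross terms cancel the last one, because \<open>N x\<close>
  is symmetric and idempotent.\<close>

lemma norm_reflector: "norm (R x *v v) = norm v"
proof -
  have "(R x *v v) \<bullet> (R x *v v) = v \<bullet> v"
    by (simp add: reflector_mult inner_diff_left inner_diff_right inner_proj_normal
        proj_normal_mult_idem)
  then show ?thesis by (simp add: norm_eq_sqrt_inner)
qed

lemma norm_proj_tangent_le: "norm (proj_tangent f x *v v) \<le> norm v"
  using norm_triangle_ineq[of v "R x *v v"] by (simp add: proj_tangent_eq norm_reflector)

section \<open>The derivative of the normal projection\<close>

definition dN :: "real^'n \<Rightarrow> real^'n \<Rightarrow> real^'n^'n" where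
  "dN x w = frechet_derivative N (at x) w"

lemma has_derivative_N: "(N has_derivative dN x) (at x)"
  unfolding dN_def[abs_def] by (rule smooth_has_derivative[OF smooth_proj_normal])

text \<open>Uniqueness of the derivative turns identities for \<open>N\<close> into identities for
  \<open>dN\<close>; the next two lemmas differentiate its symmetry and its idempotence.\<close>

lemma dN_eqI: "(N has_derivative D) (at x) \<Longrightarrow> dN x w = D w"
  unfolding dN_def using frechet_derivative_at by metis

lemma transpose_dN: "transpose (dN x w) = dN x w"
  using dN_eqI[of "\<lambda>w. transpose (dN x w)" x w]
    bounded_linear.has_derivative[OF bounded_linear_transpose has_derivative_N[of x]]
  by (simp add: transpose_proj_normal)

lemma dN_product: "dN x w = N x ** dN x w + dN x w ** N x"
  using dN_eqI[of "\<lambda>w. N x ** dN x w + dN x w ** N x" x w]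
    bounded_bilinear.FDERIV[OF bounded_bilinear_matrix_mult has_derivative_N[of x] has_derivative_N[of x]]
  by (simp add: proj_normal_idem)

text \<open>Differentiate \<open>J x ** N x = J x\<close>: if \<open>H\<close> is the derivative of
  the Jacobian along \<open>w\<close>, then \<open>H = J dN + H N\<close>, so
  \<open>J dN = H (I - N)\<close>. This is the core of the Golub-Pereyra formula.\<close>

lemma jacobian_dN: "J x ** dN x w = matrix (second_deriv f x w) ** proj_tangent f x"
proof -
  have "((\<lambda>y. J y) has_derivative frechet_derivative (\<lambda>y. J y) (at x)) (at x)" (is "(_ has_derivative ?D) _")
    by (rule smooth_has_derivative[OF smooth_jacobian])
  note D = this
  \<comment> \<open>Entrywise, the derivative of the Jacobian along \<open>w\<close> is the matrix
    of the second derivative with \<open>w\<close> in its first slot.\<close>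
  have "?D w $ i $ j = frechet_derivative (\<lambda>y. frechet_derivative f (at y) (axis j 1)) (at x) w $ i" for i j
  proof -
    have "((\<lambda>y. J y $ i $ j) has_derivative (\<lambda>w. ?D w $ i $ j)) (at x)"
      using D by (intro bounded_linear.has_derivative[OF bounded_linear_vec_nth])
    moreover have "((\<lambda>y. frechet_derivative f (at y) (axis j 1) $ i) has_derivative
        (\<lambda>w. frechet_derivative (\<lambda>y. frechet_derivative f (at y) (axis j 1)) (at x) w $ i)) (at x)"
      by (intro bounded_linear.has_derivative[OF bounded_linear_vec_nth] smooth_has_derivative
          smooth_frechet_derivative smooth_f)
    moreover have "(\<lambda>y. J y $ i $ j) = (\<lambda>y. frechet_derivative f (at y) (axis j 1) $ i)"
      by (simp add: jacobian_def matrix_def)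
    ultimately show ?thesis
      using has_derivative_unique fun_cong by metis
  qed
  then have "?D w = matrix (second_deriv f x w)"
    by (simp add: vec_eq_iff matrix_def second_deriv_def)
  moreover have "((\<lambda>y. J y) has_derivative (\<lambda>w. J x ** dN x w + ?D w ** N x)) (at x)"
    using bounded_bilinear.FDERIV[OF bounded_bilinear_matrix_mult D has_derivative_N[of x]]
    by (simp add: jacobian_proj_normal)
  then have "?D w = J x ** dN x w + ?D w ** N x"
    using fun_cong[OF has_derivative_unique[OF D]] by blast
  ultimately have "matrix (second_deriv f x w) - matrix (second_deriv f x w) ** N x = J x ** dN x w"
    by (simp add: algebra_simps)
  then show ?thesis
    using bounded_bilinear.diff_right[OF bounded_bilinear_matrix_mult]
    by (metis matrix_mul_rid proj_tangent_def)
qed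

text \<open>Since \<open>N\<close> is \<open>Jac_pinv\<close> times the Jacobian, multiplying
  \<open>jacobian_dN\<close> by \<open>Jac_pinv\<close> produces the factor
  \<open>N x\<close>.\<close>

lemma dN_perp_eq: "dN_perp f x w = N x ** dN x w"
  by (simp add: dN_perp_def proj_normal_def jacobian_dN[symmetric] flip: matrix_mul_assoc)

lemma dN_par_eq: "dN_par f x w = dN x w ** N x"
  by (simp add: dN_par_def dN_perp_eq matrix_transpose_mul transpose_dN transpose_proj_normal)

text \<open>With \<open>dN = N dN + dN N\<close>, the right-hand side \<open>2 dN N v - dN v\<close>
  collapses to the commutator \<open>dN N v - N dN v\<close>.\<close>

lemma ode_velocity_field: "(dN_par f x w - dN_perp f x w) *v v = - (dN x w *v (R x *v v))"
proof -
  have c: "dN x w *v v = N x *v (dN x w *v v) + dN x w *v (N x *v v)"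
    using arg_cong[OF dN_product[of x w], of "\<lambda>A. A *v v"]
    by (simp add: matrix_vector_mult_add_rdistrib flip: matrix_vector_mul_assoc)
  have "R x *v v = v - (N x *v v + N x *v v)"
    unfolding reflector_mult scaleR_2 ..
  then have "- (dN x w *v (R x *v v)) = dN x w *v (N x *v v) + dN x w *v (N x *v v) - dN x w *v v"
    by (simp only: matrix_vector_mult_diff_distrib matrix_vector_right_distrib minus_diff_eq)
  also have "\<dots> = dN x w *v (N x *v v) - N x *v (dN x w *v v)"
    by (subst c) (rule add_diff_cancel_right)
  also have "\<dots> = (dN_par f x w - dN_perp f x w) *v v"
    by (simp add: dN_par_eq dN_perp_eq matrix_vector_mult_diff_rdistrib flip: matrix_vector_mul_assoc)
  finally show ?thesis ..
qed

text \<open>\<open>dN_par\<close> is the transpose of \<open>dN_perp\<close>, so the difference is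
  skew. This is what conserves the speed of the solution.\<close>

lemma ode_velocity_field_orthogonal: "v \<bullet> ((dN_par f x w - dN_perp f x w) *v v) = 0"
proof -
  have "v \<bullet> (dN_par f x w *v v) = v \<bullet> (dN_perp f x w *v v)"
    unfolding dN_par_def transpose_matrix_vector by (metis dot_lmul_matrix inner_commute)
  then show ?thesis
    by (simp add: matrix_vector_mult_diff_rdistrib inner_diff_right)
qed

section \<open>The limit field and the free flight between reflections\<close>

definition limit_field :: "(real^'n) \<times> (real^'n) \<Rightarrow> (real^'n) \<times> (real^'n)" where
  "limit_field = (\<lambda>(x, v). (proj_tangent f x *v v, - (dN x (R x *v v) *v (R x *v v))))"

text \<open>Motion at half speed with frozen velocity: after time \<open>s\<close> the state
  \<open>(x, v)\<close> has become \<open>(x + (s / 2) *\<^sub>R v, v)\<close>, the half step of the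
  scheme.\<close>

definition free_flight :: "(real^'n) \<times> (real^'n) \<Rightarrow> (real^'n) \<times> (real^'n)" where
  "free_flight = (\<lambda>(x, v). ((1/2) *\<^sub>R v, 0))"

definition reflect :: "(real^'n) \<times> (real^'n) \<Rightarrow> real^'n" where
  "reflect = (\<lambda>(x, v). R x *v v)"

lemma smooth_reflect: "smooth reflect"
proof -
  have "smooth (\<lambda>z :: (real^'n) \<times> (real^'n). snd z - 2 *\<^sub>R (N (fst z) *v snd z))"
    by (intro smooth_diff smooth_bounded_linear_compose[OF bounded_linear_scaleR_right]
        smooth_bilinear[OF bounded_bilinear_matrix_vector_mult]
        smooth_bounded_linear_compose[OF bounded_linear_snd smooth_id]
        smooth_compose_bounded_linear[OF bounded_linear_fst smooth_proj_normal])
  then show ?thesis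
    by (simp add: reflect_def reflector_mult case_prod_beta')
qed

lemma smooth_limit_field: "smooth limit_field"
proof -
  have "smooth (\<lambda>z. dN (fst z) (reflect z) *v reflect z)"
    unfolding dN_def
    by (intro smooth_bilinear[OF bounded_bilinear_matrix_vector_mult] smooth_reflect
        smooth_frechet_derivative_apply[OF smooth_proj_normal bounded_linear_fst])
  moreover have "smooth (\<lambda>z :: (real^'n) \<times> (real^'n). (1/2) *\<^sub>R (snd z + reflect z))"
    by (intro smooth_bounded_linear_compose[OF bounded_linear_scaleR_right] smooth_add
        smooth_bounded_linear_compose[OF bounded_linear_snd smooth_id] smooth_reflect)
  ultimately have "smooth (\<lambda>z. ((1/2) *\<^sub>R (snd z + reflect z), - (dN (fst z) (reflect z) *v reflect z)))"
    by (intro smooth_Pair smooth_minus)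
  then show ?thesis
    by (simp add: limit_field_def reflect_def proj_tangent_eq case_prod_beta')
qed

lemma smooth_free_flight: "smooth free_flight"
  unfolding free_flight_def case_prod_beta'
  by (intro smooth_Pair smooth_bounded_linear_compose[OF bounded_linear_scaleR_right]
      smooth_bounded_linear_compose[OF bounded_linear_snd smooth_id] smooth_const)

text \<open>The factor 2 in the reflector cancels the half speed of the flight.\<close>

lemma lie_free_flight_reflect: "lie free_flight reflect (x, v) = - (dN x v *v v)"
proof -
  have 1: "((\<lambda>z :: (real^'n) \<times> (real^'n). N (fst z)) has_derivative (\<lambda>h. dN x (fst h))) (at (x, v))"
    using has_derivative_compose[OF bounded_linear_imp_has_derivative[OF bounded_linear_fst], of N "dN x" "(x, v)"]
      has_derivative_N[of x] by simp
  have 2: "(snd has_derivative snd) (at (x, v))"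
    by (rule bounded_linear_imp_has_derivative[OF bounded_linear_snd])
  have "((\<lambda>z :: (real^'n) \<times> (real^'n). N (fst z) *v snd z) has_derivative
      (\<lambda>h. N x *v snd h + dN x (fst h) *v v)) (at (x, v))"
    using bounded_bilinear.FDERIV[OF bounded_bilinear_matrix_vector_mult 1 2] by simp
  then have "((\<lambda>z :: (real^'n) \<times> (real^'n). snd z - 2 *\<^sub>R (N (fst z) *v snd z)) has_derivative
      (\<lambda>h. snd h - 2 *\<^sub>R (N x *v snd h + dN x (fst h) *v v))) (at (x, v))"
    by (intro has_derivative_diff bounded_linear.has_derivative[OF bounded_linear_scaleR_right]
        bounded_linear_imp_has_derivative[OF bounded_linear_snd])
  then have "lie free_flight reflect (x, v) = snd (free_flight (x, v)) -
      2 *\<^sub>R (N x *v snd (free_flight (x, v)) + dN x (fst (free_flight (x, v))) *v v)"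
    by (intro lie_eqI) (simp add: reflect_def reflector_mult case_prod_beta')
  moreover have "dN x ((1/2) *\<^sub>R v) = (1/2) *\<^sub>R dN x v"
    using has_derivative_linear[OF has_derivative_N] linear_scale by blast
  ultimately show ?thesis
    by (simp add: free_flight_def flip: scaleR_matrix_vector_assoc)
qed

end

subsection \<open>Error propagation for the leapfrog relation\<close>

text \<open>From one even index to the next the local error is of order \<open>d ^ 3\<close>, which
  accumulates to \<open>d\<^sup>2\<close> over a bounded time. Odd errors feed back only through a
  term multiplied by \<open>d\<close>, so the coarser one-step relation suffices there.\<close>

lemma two_step_error_bound:
  fixes z \<zeta> :: "nat \<Rightarrow> 'a::real_normed_vector"
  assumes L: "L \<ge> 0" and C: "C \<ge> 0" and d: "0 < d" "2 * L * d \<le> 1"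
    and init: "z 0 = \<zeta> 0"
    and z1: "\<And>k. odd k \<Longrightarrow> k \<le> n \<Longrightarrow> norm (z k - z (k - 1) - d *\<^sub>R F (z k)) \<le> C * d\<^sup>2"
    and \<zeta>1: "\<And>k. odd k \<Longrightarrow> k \<le> n \<Longrightarrow> norm (\<zeta> k - \<zeta> (k - 1) - d *\<^sub>R F (\<zeta> k)) \<le> C * d\<^sup>2"
    and z2: "\<And>k. odd k \<Longrightarrow> Suc k \<le> n \<Longrightarrow>
        norm (z (Suc k) - z (k - 1) - (2 * d) *\<^sub>R F (z k)) \<le> C * d ^ 3"
    and \<zeta>2: "\<And>k. odd k \<Longrightarrow> Suc k \<le> n \<Longrightarrow>
        norm (\<zeta> (Suc k) - \<zeta> (k - 1) - (2 * d) *\<^sub>R F (\<zeta> k)) \<le> C * d ^ 3"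
    and lip: "\<And>k. k \<le> n \<Longrightarrow> norm (F (z k) - F (\<zeta> k)) \<le> L * norm (z k - \<zeta> k)"
    and T: "real n * d \<le> T"
    and k: "k \<le> n"
  shows "norm (z k - \<zeta> k) \<le> (2 * T * (8 * L * C + 2 * C) * exp (4 * L * T) + 4 * C) * d\<^sup>2"
proof -
  define e where "e j = norm (z j - \<zeta> j)" for j
  \<comment> \<open>Local error of a double step: \<open>2 * C\<close> from the two leapfrog
    defects, \<open>8 * L * C\<close> from inserting the odd-index defect
    \<open>4 * C * d\<^sup>2\<close> into \<open>2 * d * L * e j\<close>.\<close>
  define A where "A = 8 * L * C + 2 * C"
  have A: "A \<ge> 0" using L C by (simp add: A_def)
  have T0: "T \<ge> 0" using T d by (meson less_imp_le mult_nonneg_nonneg of_nat_0_le_iff order_trans)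
  have odd_step: "e j \<le> 2 * e (j - 1) + 4 * C * d\<^sup>2" if j: "odd j" "j \<le> n" for j
  proof -
    have "z j - \<zeta> j = (z (j - 1) - \<zeta> (j - 1)) + d *\<^sub>R (F (z j) - F (\<zeta> j)) +
        (z j - z (j - 1) - d *\<^sub>R F (z j)) - (\<zeta> j - \<zeta> (j - 1) - d *\<^sub>R F (\<zeta> j))"
      by (simp add: algebra_simps)
    also have "norm \<dots> \<le> (e (j - 1) + d * (L * e j) + C * d\<^sup>2) + C * d\<^sup>2"
      using j lip[of j] d unfolding e_def
      by (intro norm_diff_add_le z1 \<zeta>1 order_refl) (simp_all add: mult_left_mono)
    finally have "e j \<le> e (j - 1) + (L * d) * e j + 2 * C * d\<^sup>2"
      by (simp add: e_def algebra_simps)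
    \<comment> \<open>The one-step relation is implicit, with \<open>F\<close> at the new point. The
      smallness of \<open>d\<close> absorbs half of \<open>e j\<close> on the left, which doubles
      the other terms.\<close>
    moreover have "(L * d) * e j \<le> (1/2) * e j"
      using d by (intro mult_right_mono) (simp_all add: e_def)
    ultimately show ?thesis by linarith
  qed
  have even_step: "e (Suc j) \<le> (1 + 4 * L * d) * e (j - 1) + A * d ^ 3" if j: "odd j" "Suc j \<le> n" for j
  proof -
    have "z (Suc j) - \<zeta> (Suc j) = (z (j - 1) - \<zeta> (j - 1)) + (2 * d) *\<^sub>R (F (z j) - F (\<zeta> j)) +
        (z (Suc j) - z (j - 1) - (2 * d) *\<^sub>R F (z j)) - (\<zeta> (Suc j) - \<zeta> (j - 1) - (2 * d) *\<^sub>R F (\<zeta> j))"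
      by (simp add: algebra_simps)
    also have "norm \<dots> \<le> (e (j - 1) + (2 * d) * (L * e j) + C * d ^ 3) + C * d ^ 3"
      using j lip[of j] d unfolding e_def
      by (intro norm_diff_add_le z2 \<zeta>2 order_refl) (simp_all add: mult_left_mono)
    finally have "e (Suc j) \<le> e (j - 1) + 2 * d * L * e j + 2 * C * d ^ 3"
      by (simp add: e_def algebra_simps)
    moreover have "2 * d * L * e j \<le> 2 * d * L * (2 * e (j - 1) + 4 * C * d\<^sup>2)"
      using odd_step[of j] j d L by (intro mult_left_mono) auto
    ultimately show ?thesis
      by (simp add: A_def algebra_simps power2_eq_square power3_eq_cube)
  qed
  \<comment> \<open>Discrete Gronwall: each double step multiplies the error by at most
    \<open>exp (4 * L * d)\<close> and adds one defect \<open>A * d ^ 3\<close>.\<close>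
  have even_bound: "e (2 * j) \<le> real j * A * d ^ 3 * exp (4 * L * d * real j)" if "2 * j \<le> n" for j
    using that
  proof (induction j)
    case 0
    then show ?case by (simp add: e_def init)
  next
    case (Suc j)
    let ?E = "exp (4 * L * d * real j)"
    have E: "exp (4 * L * d * real (Suc j)) = exp (4 * L * d) * ?E"
      by (simp add: algebra_simps flip: exp_add)
    have E1: "exp (4 * L * d * real (Suc j)) \<ge> 1"
      using L d by simp
    have "e (2 * Suc j) \<le> (1 + 4 * L * d) * e (2 * j) + A * d ^ 3"
      using even_step[of "Suc (2 * j)"] Suc.prems by simp
    also have "\<dots> \<le> exp (4 * L * d) * (real j * A * d ^ 3 * ?E) + A * d ^ 3"
      using Suc L d exp_ge_add_one_self[of "4 * L * d"]
      by (intro add_right_mono mult_mono) (auto simp: e_def)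
    also have "\<dots> \<le> exp (4 * L * d) * (real j * A * d ^ 3 * ?E) + A * d ^ 3 * exp (4 * L * d * real (Suc j))"
      using mult_left_mono[OF E1, of "A * d ^ 3"] A d by simp
    also have "\<dots> = real (Suc j) * A * d ^ 3 * exp (4 * L * d * real (Suc j))"
      unfolding E by (simp add: algebra_simps)
    finally show ?case .
  qed
  have even: "e (2 * j) \<le> T * A * exp (4 * L * T) * d\<^sup>2" if "2 * j \<le> n" for j
  proof -
    have "real j * d \<le> real n * d"
      using that d by (intro mult_right_mono) auto
    then have jd: "real j * d \<le> T" using T by linarith
    \<comment> \<open>One power of \<open>d\<close> is combined with the number of double steps into
      a time bounded by \<open>T\<close>.\<close>
    have "e (2 * j) \<le> (real j * d) * A * d\<^sup>2 * exp (4 * L * (real j * d))"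
      using even_bound[OF that] by (simp add: power2_eq_square power3_eq_cube algebra_simps)
    also have "\<dots> \<le> T * A * d\<^sup>2 * exp (4 * L * T)"
      using jd A T0 L d by (intro mult_mono) (auto intro: mult_left_mono)
    finally show ?thesis by (simp add: algebra_simps)
  qed
  have P: "T * A * exp (4 * L * T) * d\<^sup>2 \<ge> 0" "C * d\<^sup>2 \<ge> 0"
    using T0 A C by simp_all
  have ev: "e (2 * (k div 2)) \<le> T * A * exp (4 * L * T) * d\<^sup>2"
    using k by (intro even) linarith
  have "e k \<le> 2 * (T * A * exp (4 * L * T) * d\<^sup>2) + 4 * (C * d\<^sup>2)"
  proof (cases "even k")
    case True
    then have "2 * (k div 2) = k" by simp
    then show ?thesis using ev P by simp
  next
    case False
    then have "2 * (k div 2) = k - 1" by presburger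
    then have "e k \<le> 2 * e (2 * (k div 2)) + 4 * (C * d\<^sup>2)"
      using odd_step[OF False k] by (simp add: mult.assoc)
    then show ?thesis using ev by linarith
  qed
  then show ?thesis by (simp add: e_def A_def algebra_simps)
qed

subsection \<open>The bounce scheme and the limit equation\<close>

context full_rank_map
begin

text \<open>Both steps pass through the same midpoint, where the reflection is an
  involution.\<close>

lemma bounce_step_reverse: "bounce_step f (-d) (bounce_step f d z) = z"
  by (cases z) (simp add: bounce_step_def Let_def reflector_involution)

lemma bounce_step_eq_reflect:
  "bounce_step f s (x, v) =
     (x + (s / 2) *\<^sub>R (v + reflect (x + (s / 2) *\<^sub>R v, v)), reflect (x + (s / 2) *\<^sub>R v, v))"
  by (simp add: bounce_step_def Let_def reflect_def algebra_simps)

text \<open>Unflipping an odd state \<open>(x, v)\<close> gives \<open>(x, R x *v v)\<close>. The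
  involution undoes the reflection inside the field, leaving exactly the quantities that Taylor
  expansion at the raw state \<open>(x, v)\<close> produces.\<close>

lemma limit_field_reflect:
  "limit_field (x, R x *v v) = ((1/2) *\<^sub>R (v + reflect (x, v)), lie free_flight reflect (x, v))"
  unfolding lie_free_flight_reflect
  by (simp add: limit_field_def proj_tangent_eq reflector_involution reflect_def add.commute)

text \<open>Both steps are values of one formula at \<open>s = d\<close> and \<open>s = -d\<close>,
  so \<open>symmetric_expansion\<close> applies to \<open>reflect\<close> along the free flight
  through \<open>(x, v)\<close>. Keeping that flight in \<open>K\<close> makes the constant
  uniform.\<close>

lemma bounce_step_expansion:
  assumes "compact K"
  obtains C where "C \<ge> 0"
    "\<And>x v d. 0 \<le> d \<Longrightarrow> (\<And>s. s \<in> {-d..d} \<Longrightarrow> (x + (s / 2) *\<^sub>R v, v) \<in> K) \<Longrightarrow>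
      norm ((x, R x *v v) - bounce_step f (-d) (x, v) - d *\<^sub>R limit_field (x, R x *v v)) \<le> C * d\<^sup>2"
    "\<And>x v d. 0 \<le> d \<Longrightarrow> (\<And>s. s \<in> {-d..d} \<Longrightarrow> (x + (s / 2) *\<^sub>R v, v) \<in> K) \<Longrightarrow>
      norm (bounce_step f d (x, v) - bounce_step f (-d) (x, v) - (2 * d) *\<^sub>R limit_field (x, R x *v v)) \<le> C * d ^ 3"
proof -
  obtain C where C: "C \<ge> 0"
    "\<And>z t d. d \<ge> 0 \<Longrightarrow> integral_curve free_flight K {t-d..t} z \<Longrightarrow>
       norm (reflect (z t) - reflect (z (t - d))) \<le> C * d"
    "\<And>z t d. d \<ge> 0 \<Longrightarrow> integral_curve free_flight K {t-d..t} z \<Longrightarrow>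
       norm (reflect (z t) - reflect (z (t - d)) - d *\<^sub>R lie free_flight reflect (z t)) \<le> C * d ^ 2"
    "\<And>z t d. d \<ge> 0 \<Longrightarrow> integral_curve free_flight K {t-d..t+d} z \<Longrightarrow>
       norm (reflect (z (t + d)) - reflect (z (t - d)) - (2 * d) *\<^sub>R lie free_flight reflect (z t)) \<le> C * d ^ 3"
    "\<And>z t d. d \<ge> 0 \<Longrightarrow> integral_curve free_flight K {t-d..t+d} z \<Longrightarrow>
       norm (reflect (z (t + d)) + reflect (z (t - d)) - 2 *\<^sub>R reflect (z t)) \<le> C * d ^ 2"
    using symmetric_expansion[OF smooth_free_flight smooth_reflect assms] by blast
  show ?thesis
  \<comment> \<open>The norm of a pair is at most the sum of the norms of its components, and each
    contributes \<open>C\<close>.\<close>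
  proof (rule that[of "2 * C"])
    show "0 \<le> 2 * C" using C by simp
    fix x v d assume d: "0 \<le> (d :: real)"
      and K: "\<And>s. s \<in> {-d..d} \<Longrightarrow> (x + (s / 2) *\<^sub>R v, v) \<in> K"
    define h where "h s = reflect (x + (s / 2) *\<^sub>R v, v)" for s
    define l where "l = lie free_flight reflect (x, v)"
    have D: "((\<lambda>s. (x + (s / 2) *\<^sub>R v, v)) has_vector_derivative free_flight (x + (s / 2) *\<^sub>R v, v))
        (at s within S)" for s S
      unfolding free_flight_def
      by (auto intro!: derivative_eq_intros has_vector_derivative_Pair)
    have curve: "integral_curve free_flight K {0-d..0+d} (\<lambda>s. (x + (s / 2) *\<^sub>R v, v))"
      using D K by (auto simp: integral_curve_def)
    then have curve': "integral_curve free_flight K {0-d..0} (\<lambda>s. (x + (s / 2) *\<^sub>R v, v))"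
      using d by (auto intro: integral_curve_subset)
    have e0: "norm (h 0 - h (-d)) \<le> C * d"
      using C(2)[OF d curve'] by (simp add: h_def)
    have e1: "norm (h 0 - h (-d) - d *\<^sub>R l) \<le> C * d\<^sup>2"
      using C(3)[OF d curve'] by (simp add: h_def l_def)
    have e2: "norm (h d - h (-d) - (2 * d) *\<^sub>R l) \<le> C * d ^ 3"
      using C(4)[OF d curve] by (simp add: h_def l_def)
    have e3: "norm (h d + h (-d) - 2 *\<^sub>R h 0) \<le> C * d\<^sup>2"
      using C(5)[OF d curve] by (simp add: h_def)
    have step: "bounce_step f s (x, v) = (x + (s / 2) *\<^sub>R (v + h s), h s)" for s
      by (simp add: bounce_step_eq_reflect h_def)
    have Rx: "R x *v v = h 0"
      by (simp add: h_def reflect_def)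
    have F: "limit_field (x, h 0) = ((1/2) *\<^sub>R (v + h 0), l)"
      using limit_field_reflect[of x v] by (simp add: h_def reflect_def l_def)
    have "(x, R x *v v) - bounce_step f (-d) (x, v) - d *\<^sub>R limit_field (x, R x *v v) =
        (- (d / 2) *\<^sub>R (h 0 - h (-d)), h 0 - h (-d) - d *\<^sub>R l)"
      unfolding Rx F step by (simp add: vec_eq_iff field_simps)
    moreover have "norm (- (d / 2) *\<^sub>R (h 0 - h (-d))) \<le> C * d\<^sup>2"
    proof -
      have "norm (- (d / 2) *\<^sub>R (h 0 - h (-d))) \<le> d * (C * d)"
        unfolding norm_scaleR using e0 d C(1) by (intro mult_mono) auto
      then show ?thesis by (simp add: power2_eq_square mult_ac)
    qed
    ultimately show "norm ((x, R x *v v) - bounce_step f (-d) (x, v) - d *\<^sub>R limit_field (x, R x *v v))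
        \<le> 2 * C * d\<^sup>2"
      using e1 norm_Pair_le[of "- (d / 2) *\<^sub>R (h 0 - h (-d))" "h 0 - h (-d) - d *\<^sub>R l"] by simp
    \<comment> \<open>The velocities of the two steps add up in the position and subtract in the
      velocity. The symmetric sum is accurate only to second order, but the prefactor
      \<open>d / 2\<close> supplies the third.\<close>
    have "bounce_step f d (x, v) - bounce_step f (-d) (x, v) - (2 * d) *\<^sub>R limit_field (x, R x *v v) =
        ((d / 2) *\<^sub>R (h d + h (-d) - 2 *\<^sub>R h 0), h d - h (-d) - (2 * d) *\<^sub>R l)"
      unfolding Rx F step by (simp add: vec_eq_iff field_simps)
    moreover have "norm ((d / 2) *\<^sub>R (h d + h (-d) - 2 *\<^sub>R h 0)) \<le> C * d ^ 3"
    proof -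
      have "norm ((d / 2) *\<^sub>R (h d + h (-d) - 2 *\<^sub>R h 0)) \<le> d * (C * d\<^sup>2)"
        unfolding norm_scaleR using e3 d C(1) by (intro mult_mono) auto
      then show ?thesis by (simp add: power2_eq_square power3_eq_cube mult_ac)
    qed
    ultimately show "norm (bounce_step f d (x, v) - bounce_step f (-d) (x, v) -
        (2 * d) *\<^sub>R limit_field (x, R x *v v)) \<le> 2 * C * d ^ 3"
      using e2 norm_Pair_le[of "(d / 2) *\<^sub>R (h d + h (-d) - 2 *\<^sub>R h 0)" "h d - h (-d) - (2 * d) *\<^sub>R l"]
      by simp
  qed
qed

section \<open>A priori bounds for the iterates and for the solution\<close>

lemma bounce_iter_bounds:
  assumes "0 \<le> d"
  shows "norm (snd (bounce_iter f d x0 v0 k)) = norm v0"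
    and "norm (fst (bounce_iter f d x0 v0 k) - x0) \<le> real k * d * norm v0"
proof -
  have "norm (snd (bounce_iter f d x0 v0 k)) = norm v0 \<and>
    norm (fst (bounce_iter f d x0 v0 k) - x0) \<le> real k * d * norm v0"
  proof (induction k)
    case 0
    then show ?case by (simp add: bounce_iter_def)
  next
    case (Suc k)
    obtain x v where xv: "bounce_iter f d x0 v0 k = (x, v)" by fastforce
    define w where "w = R (x + (d / 2) *\<^sub>R v) *v v"
    have next_state: "bounce_iter f d x0 v0 (Suc k) = (x + (d / 2) *\<^sub>R v + (d / 2) *\<^sub>R w, w)"
      using xv by (simp add: bounce_iter_def bounce_step_def Let_def w_def)
    have n: "norm v = norm v0" "norm w = norm v0" "norm (x - x0) \<le> real k * d * norm v0"
      using Suc xv by (simp_all add: w_def norm_reflector)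
    have "norm ((x - x0) + (d / 2) *\<^sub>R v + (d / 2) *\<^sub>R w) \<le>
        real k * d * norm v0 + (d / 2) * norm v0 + (d / 2) * norm v0"
      using n assms by (intro norm_diff_add_le) auto
    then show ?case
      using n next_state by (simp add: algebra_simps)
  qed
  then show "norm (snd (bounce_iter f d x0 v0 k)) = norm v0"
    and "norm (fst (bounce_iter f d x0 v0 k) - x0) \<le> real k * d * norm v0" by auto
qed

lemma solves_limit_ode_integral_curve:
  assumes "solves_limit_ode f x0 v0 tend x v" "t \<in> {0..tend}"
  shows "((\<lambda>t. (x t, v t)) has_vector_derivative limit_field (x t, v t)) (at t within {0..tend})"
proof -
  have "(proj_tangent f y - N y) *v u = R y *v u" for y u
    by (simp add: matrix_vector_mult_diff_rdistrib proj_tangent_mult reflector_mult scaleR_2)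
  then show ?thesis
    using assms unfolding solves_limit_ode_def limit_field_def
    by (auto simp: Let_def ode_velocity_field intro!: has_vector_derivative_Pair)
qed

lemma solves_limit_ode_bounds:
  assumes "solves_limit_ode f x0 v0 tend x v" "t \<in> {0..tend}"
  shows "norm (v t) = norm v0" "norm (x t - x0) \<le> t * norm v0"
proof -
  have norm_v: "norm (v s) = norm v0" if s: "s \<in> {0..tend}" for s
  proof -
    have "((\<lambda>t. v t \<bullet> v t) has_derivative (\<lambda>h. 0)) (at r within {0..tend})" if r: "r \<in> {0..tend}" for r
    proof -
      have "\<exists>w. (v has_vector_derivative (dN_par f (x r) w - dN_perp f (x r) w) *v v r) (at r within {0..tend})"
        using assms(1) r unfolding solves_limit_ode_def Let_def by blast
      then obtain v' where v': "(v has_vector_derivative v') (at r within {0..tend})" "v r \<bullet> v' = 0"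
        using ode_velocity_field_orthogonal by blast
      show ?thesis
        using bounded_bilinear.has_vector_derivative[OF bounded_bilinear_inner v'(1) v'(1)] v'(2)
        by (simp add: has_vector_derivative_def inner_commute)
    qed
    then obtain c where "\<forall>r\<in>{0..tend}. v r \<bullet> v r = c"
      using has_derivative_zero_constant[of "{0..tend}" "\<lambda>t. v t \<bullet> v t"] by auto
    then have "v s \<bullet> v s = v 0 \<bullet> v 0" using s by auto
    then show ?thesis
      using assms(1) by (simp add: norm_eq_sqrt_inner solves_limit_ode_def)
  qed
  then show "norm (v t) = norm v0" using assms by simp
  \<comment> \<open>For \<open>p = 1\<close> and this family, \<open>taylor_bound\<close> is the
    mean value inequality for the position.\<close>
  define D where "D i s = (if i = 0 then x s else proj_tangent f (x s) *v v s)" for i :: nat and s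
  have "(D i has_vector_derivative D (Suc i) s) (at s within {0..t})" if "i < 1" "s \<in> {0..t}" for i s
  proof (rule has_vector_derivative_within_subset)
    show "(D i has_vector_derivative D (Suc i) s) (at s within {0..tend})"
      using assms that by (simp add: D_def[abs_def] solves_limit_ode_def)
    show "{0..t} \<subseteq> {0..tend}" using assms(2) by auto
  qed
  moreover have "norm (D 1 s) \<le> norm v0" if "s \<in> {0..t}" for s
    using norm_proj_tangent_le[of "x s" "v s"] norm_v[of s] that assms by (simp add: D_def)
  ultimately have "norm (D 0 t - (\<Sum>i<1. ((t - 0) ^ i / fact i) *\<^sub>R D i 0)) \<le> norm v0 * (t - 0) ^ 1"
    using assms by (intro taylor_bound) auto
  then show "norm (x t - x0) \<le> t * norm v0"
    using assms(1) by (simp add: D_def solves_limit_ode_def mult.commute)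
qed

section \<open>Comparison of the iterates with the solution\<close>

definition unflipped :: "real \<Rightarrow> real^'n \<Rightarrow> real^'n \<Rightarrow> nat \<Rightarrow> (real^'n) \<times> (real^'n)" where
  "unflipped d x0 v0 k = (let (x, v) = bounce_iter f d x0 v0 k in (x, if even k then v else R x *v v))"

text \<open>The constants are fixed before any solution is considered: the a priori bounds place
  every solution and all iterates up to time \<open>tend\<close> in one compact convex set.\<close>

lemma bounce_convergence:
  assumes "0 \<le> tend"
  obtains C \<delta>0 where "C > 0" "\<delta>0 > 0"
    "\<And>x v d k. solves_limit_ode f x0 v0 tend x v \<Longrightarrow> 0 < d \<Longrightarrow> d < \<delta>0 \<Longrightarrow> real k * d \<le> tend \<Longrightarrow>
       norm (fst (bounce_iter f d x0 v0 k) - x (real k * d)) \<le> C * d\<^sup>2"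
    "\<And>x v d k. solves_limit_ode f x0 v0 tend x v \<Longrightarrow> 0 < d \<Longrightarrow> d < \<delta>0 \<Longrightarrow> real k * d \<le> tend \<Longrightarrow>
       norm (snd (bounce_iter f d x0 v0 k) -
         (if even k then v (real k * d) else R (x (real k * d)) *v v (real k * d))) \<le> C * d\<^sup>2"
proof -
  \<comment> \<open>Positions stay within \<open>norm v0 * tend\<close> of \<open>x0\<close>; the
    extra \<open>norm v0\<close> makes room for the free flight around a state when \<open>d\<close>
    is at most 1.\<close>
  define K where "K = cball x0 (norm v0 * (tend + 1)) \<times> cball (0 :: real^'n) (norm v0)"
  have K: "compact K" "convex K"
    by (simp_all add: K_def compact_Times convex_Times)
  have K_memI: "(y, u) \<in> K" if "norm (y - x0) \<le> norm v0 * (tend + 1)" "norm u \<le> norm v0" for y u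
    using that by (simp add: K_def dist_norm norm_minus_commute)
  obtain L where L: "L \<ge> 0"
    "\<And>y z. y \<in> K \<Longrightarrow> z \<in> K \<Longrightarrow> norm (limit_field y - limit_field z) \<le> L * norm (y - z)"
    using smooth_lipschitz_on_compact[OF smooth_limit_field K] by blast
  obtain M where M: "M \<ge> 0"
    "\<And>y z. y \<in> K \<Longrightarrow> z \<in> K \<Longrightarrow> norm (reflect y - reflect z) \<le> M * norm (y - z)"
    using smooth_lipschitz_on_compact[OF smooth_reflect K] by blast
  obtain C1 where C1: "C1 \<ge> 0"
    "\<And>x v d. 0 \<le> d \<Longrightarrow> (\<And>s. s \<in> {-d..d} \<Longrightarrow> (x + (s / 2) *\<^sub>R v, v) \<in> K) \<Longrightarrow>
      norm ((x, R x *v v) - bounce_step f (-d) (x, v) - d *\<^sub>R limit_field (x, R x *v v)) \<le> C1 * d\<^sup>2"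
    "\<And>x v d. 0 \<le> d \<Longrightarrow> (\<And>s. s \<in> {-d..d} \<Longrightarrow> (x + (s / 2) *\<^sub>R v, v) \<in> K) \<Longrightarrow>
      norm (bounce_step f d (x, v) - bounce_step f (-d) (x, v) - (2 * d) *\<^sub>R limit_field (x, R x *v v)) \<le> C1 * d ^ 3"
    using bounce_step_expansion[OF K(1)] by blast
  \<comment> \<open>For the identity map, the symmetric expansion describes the solution
    itself.\<close>
  have lie_id: "lie limit_field (\<lambda>z. z) z = limit_field z" for z
    by (rule lie_eqI) (rule has_derivative_ident)
  obtain C2 where C2: "C2 \<ge> 0"
    "\<And>z t d. d \<ge> 0 \<Longrightarrow> integral_curve limit_field K {t-d..t} z \<Longrightarrow>
       norm (z t - z (t - d) - d *\<^sub>R limit_field (z t)) \<le> C2 * d ^ 2"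
    "\<And>z t d. d \<ge> 0 \<Longrightarrow> integral_curve limit_field K {t-d..t+d} z \<Longrightarrow>
       norm (z (t + d) - z (t - d) - (2 * d) *\<^sub>R limit_field (z t)) \<le> C2 * d ^ 3"
  proof (rule symmetric_expansion[OF smooth_limit_field smooth_id K(1), unfolded lie_id])
    fix C assume "C \<ge> 0"
      and "\<And>z t d. d \<ge> 0 \<Longrightarrow> integral_curve limit_field K {t-d..t} z \<Longrightarrow>
        norm (z t - z (t - d) - d *\<^sub>R limit_field (z t)) \<le> C * d ^ 2"
      and "\<And>z t d. d \<ge> 0 \<Longrightarrow> integral_curve limit_field K {t-d..t+d} z \<Longrightarrow>
        norm (z (t + d) - z (t - d) - (2 * d) *\<^sub>R limit_field (z t)) \<le> C * d ^ 3"
    then show thesis by (rule that)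
  qed
  \<comment> \<open>\<open>C\<close> bounds the defects of scheme and solution alike;
    \<open>B\<close> is the resulting constant of \<open>two_step_error_bound\<close> at
    \<open>T = tend\<close>.\<close>
  define C where "C = C1 + C2"
  define B where "B = 2 * tend * (8 * L * C + 2 * C) * exp (4 * L * tend) + 4 * C"
  have C: "C \<ge> 0" "C1 \<le> C" "C2 \<le> C" using C1 C2 by (simp_all add: C_def)
  have B: "B \<ge> 0" using C L assms by (simp add: B_def)
  \<comment> \<open>Chosen to give both \<open>d \<le> 1\<close>, for the margin in
    \<open>K\<close>, and the absorption condition \<open>2 * L * d \<le> 1\<close>.\<close>
  define \<delta>0 where "\<delta>0 = 1 / (2 * L + 1)"
  have \<delta>0: "\<delta>0 > 0" "\<delta>0 \<le> 1" "2 * L * \<delta>0 \<le> 1"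
    using L(1) by (simp_all add: \<delta>0_def field_simps)
  have main: "unflipped d x0 v0 k \<in> K \<and> (x (real k * d), v (real k * d)) \<in> K \<and>
      norm (unflipped d x0 v0 k - (x (real k * d), v (real k * d))) \<le> B * d\<^sup>2"
    if ode: "solves_limit_ode f x0 v0 tend x v" and d: "0 < d" "d < \<delta>0" and k: "real k * d \<le> tend"
    for x v d k
  proof -
    define b where "b = bounce_iter f d x0 v0"
    define z where "z = unflipped d x0 v0"
    define \<zeta> where "\<zeta> t = (x t, v t)" for t
    have d1: "0 \<le> d" "d \<le> 1" and Ld: "2 * L * d \<le> 1"
      using d \<delta>0 mult_left_mono[of d \<delta>0 "2 * L"] L(1) by auto
    have jt: "real j * d \<in> {0..tend}" if "j \<le> k" for j
    proof -
      have "real j * d \<le> real k * d" using that d by (intro mult_right_mono) auto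
      then have "real j * d \<le> tend" using k by (rule order_trans)
      then show ?thesis using d by simp
    qed
    have b_Suc: "b (Suc j) = bounce_step f d (b j)" for j
      by (simp add: b_def bounce_iter_def)
    \<comment> \<open>Seen from an odd state, the predecessor is a step of size \<open>-d\<close>;
      with the forward step this gives the symmetric pair of
      \<open>bounce_step_expansion\<close>.\<close>
    have b_pred: "b (j - 1) = bounce_step f (-d) (b j)" if "odd j" for j
      using that b_Suc[of "j - 1"] by (simp add: bounce_step_reverse odd_pos)
    have z_even: "z j = b j" if "even j" for j
      using that by (simp add: z_def unflipped_def b_def Let_def case_prod_beta')
    have z_odd: "z j = (fst (b j), R (fst (b j)) *v snd (b j))" if "odd j" for j
      using that by (simp add: z_def unflipped_def b_def Let_def case_prod_beta')
    have b_bound: "norm (snd (b j)) = norm v0" "norm (fst (b j) - x0) \<le> norm v0 * tend" if "j \<le> k" for j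
    proof -
      show "norm (snd (b j)) = norm v0"
        using bounce_iter_bounds(1)[OF d1(1)] by (simp add: b_def)
      have "norm (fst (b j) - x0) \<le> (real j * d) * norm v0"
        using bounce_iter_bounds(2)[OF d1(1)] by (simp add: b_def)
      also have "\<dots> \<le> tend * norm v0"
        using jt[OF that] by (intro mult_right_mono) auto
      finally show "norm (fst (b j) - x0) \<le> norm v0 * tend" by (simp add: mult.commute)
    qed
    have zK: "z j \<in> K" if "j \<le> k" for j
    proof (cases "even j")
      case True
      then show ?thesis
        using b_bound[OF that] z_even K_memI[of "fst (b j)" "snd (b j)"] by (simp add: distrib_left add_increasing2)
    next
      case False
      then show ?thesis
        using b_bound[OF that] z_odd
        by (auto intro!: K_memI simp: norm_reflector distrib_left add_increasing2)
    qed
    have flight: "(fst (b j) + (s / 2) *\<^sub>R snd (b j), snd (b j)) \<in> K" if "j \<le> k" "s \<in> {-d..d}" for j s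
    proof (rule K_memI)
      have "norm ((s / 2) *\<^sub>R snd (b j)) \<le> 1 * norm v0"
        unfolding norm_scaleR b_bound(1)[OF that(1)] using that(2) d1 by (intro mult_right_mono) auto
      then have "norm ((fst (b j) - x0) + (s / 2) *\<^sub>R snd (b j)) \<le> norm v0 * tend + 1 * norm v0"
        using b_bound(2)[OF that(1)] by (intro norm_diff_add_le)
      then show "norm (fst (b j) + (s / 2) *\<^sub>R snd (b j) - x0) \<le> norm v0 * (tend + 1)"
        by (simp add: algebra_simps)
    qed (simp add: b_bound(1)[OF that(1)])
    have \<zeta>K: "\<zeta> t \<in> K" if "t \<in> {0..tend}" for t
    proof -
      have "t * norm v0 \<le> norm v0 * (tend + 1)"
        using that mult_left_mono[of t "tend + 1" "norm v0"] by (simp add: mult.commute)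
      then show ?thesis
        using solves_limit_ode_bounds[OF ode that] by (auto simp: \<zeta>_def intro!: K_memI)
    qed
    have curve: "integral_curve limit_field K {0..tend} \<zeta>"
      using solves_limit_ode_integral_curve[OF ode] \<zeta>K
      by (auto simp: integral_curve_def \<zeta>_def[abs_def])
    have shift: "real (j - 1) * d = real j * d - d" if "odd j" for j
      using that by (simp add: of_nat_diff odd_pos Suc_leI left_diff_distrib)
    have "norm (z k - \<zeta> (real k * d)) \<le> B * d\<^sup>2"
      unfolding B_def
    proof (rule two_step_error_bound[where F = limit_field and \<zeta> = "\<lambda>j. \<zeta> (real j * d)" and n = k
          and L = L and C = C and T = tend and z = z and d = d])
      show "z 0 = \<zeta> (real 0 * d)"
        using ode by (simp add: z_even b_def bounce_iter_def \<zeta>_def solves_limit_ode_def)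
      show "norm (z j - z (j - 1) - d *\<^sub>R limit_field (z j)) \<le> C * d\<^sup>2" if "odd j" "j \<le> k" for j
      proof -
        have "norm (z j - z (j - 1) - d *\<^sub>R limit_field (z j)) \<le> C1 * d\<^sup>2"
          using C1(2)[OF d1(1) flight[OF that(2)]] that(1) b_pred[OF that(1)]
          by (simp add: z_odd z_even)
        also have "\<dots> \<le> C * d\<^sup>2" using C by (intro mult_right_mono) auto
        finally show ?thesis .
      qed
      show "norm (z (Suc j) - z (j - 1) - (2 * d) *\<^sub>R limit_field (z j)) \<le> C * d ^ 3"
        if "odd j" "Suc j \<le> k" for j
      proof -
        have "norm (z (Suc j) - z (j - 1) - (2 * d) *\<^sub>R limit_field (z j)) \<le> C1 * d ^ 3"
          using C1(3)[OF d1(1) flight[of j]] that b_pred[OF that(1)] b_Suc[of j]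
          by (simp add: z_odd z_even)
        also have "\<dots> \<le> C * d ^ 3" using C d1 by (intro mult_right_mono) auto
        finally show ?thesis .
      qed
      show "norm (\<zeta> (real j * d) - \<zeta> (real (j - 1) * d) - d *\<^sub>R limit_field (\<zeta> (real j * d))) \<le> C * d\<^sup>2"
        if "odd j" "j \<le> k" for j
      proof -
        have "{real j * d - d..real j * d} \<subseteq> {0..tend}"
          using jt[of j] jt[of "j - 1"] that shift[OF that(1)] by auto
        then have "norm (\<zeta> (real j * d) - \<zeta> (real j * d - d) - d *\<^sub>R limit_field (\<zeta> (real j * d))) \<le> C2 * d\<^sup>2"
          by (intro C2(2) d1 integral_curve_subset[OF curve])
        also have "\<dots> \<le> C * d\<^sup>2" using C by (intro mult_right_mono) auto
        finally show ?thesis by (simp only: shift[OF that(1)])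
      qed
      show "norm (\<zeta> (real (Suc j) * d) - \<zeta> (real (j - 1) * d) - (2 * d) *\<^sub>R limit_field (\<zeta> (real j * d))) \<le> C * d ^ 3"
        if "odd j" "Suc j \<le> k" for j
      proof -
        have s: "real (Suc j) * d = real j * d + d" by (simp add: algebra_simps)
        have "{real j * d - d..real j * d + d} \<subseteq> {0..tend}"
          using jt[of "Suc j"] jt[of "j - 1"] that shift[OF that(1)] s by auto
        then have "norm (\<zeta> (real j * d + d) - \<zeta> (real j * d - d) - (2 * d) *\<^sub>R limit_field (\<zeta> (real j * d))) \<le> C2 * d ^ 3"
          by (intro C2(3) d1 integral_curve_subset[OF curve])
        also have "\<dots> \<le> C * d ^ 3" using C d1 by (intro mult_right_mono) auto
        finally show ?thesis by (simp only: shift[OF that(1)] s)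
      qed
      show "norm (limit_field (z j) - limit_field (\<zeta> (real j * d))) \<le> L * norm (z j - \<zeta> (real j * d))"
        if "j \<le> k" for j
        using that by (intro L(2) zK \<zeta>K jt)
    qed (use L C d Ld k in auto)
    then show ?thesis
      using zK[of k] \<zeta>K[OF jt[of k]] by (simp add: z_def \<zeta>_def)
  qed
  show ?thesis
  \<comment> \<open>\<open>B\<close> covers positions and even velocities, \<open>B * M\<close> the
    odd velocities through the Lipschitz constant of \<open>reflect\<close>, and the summand 1 makes
    the constant positive.\<close>
  proof (rule that[of "B * (1 + M) + 1" \<delta>0])
    show "B * (1 + M) + 1 > 0" using B M(1) by (simp add: add_nonneg_pos)
    show "\<delta>0 > 0" by (rule \<delta>0)
    fix x v d k
    assume *: "solves_limit_ode f x0 v0 tend x v" "0 < d" "d < \<delta>0" "real k * d \<le> tend"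
    let ?z = "unflipped d x0 v0 k" and ?\<zeta> = "(x (real k * d), v (real k * d))"
    note bound = main[OF *]
    obtain y u where yu: "bounce_iter f d x0 v0 k = (y, u)" by fastforce
    have B1: "B * d\<^sup>2 \<le> (B * (1 + M) + 1) * d\<^sup>2"
      using B M(1) by (intro mult_right_mono) (simp_all add: distrib_left add_increasing2)
    have "M * norm (?z - ?\<zeta>) \<le> M * (B * d\<^sup>2)"
      using bound M(1) by (intro mult_left_mono) auto
    also have "\<dots> \<le> (B * (1 + M) + 1) * d\<^sup>2"
      using B by (simp add: algebra_simps)
    finally have B2: "M * norm (?z - ?\<zeta>) \<le> (B * (1 + M) + 1) * d\<^sup>2" .
    have "norm (fst ?z - fst ?\<zeta>) \<le> norm (?z - ?\<zeta>)"
      by (metis minus_prod_def norm_fst_le)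
    then show "norm (fst (bounce_iter f d x0 v0 k) - x (real k * d)) \<le> (B * (1 + M) + 1) * d\<^sup>2"
      using bound B1 by (simp add: unflipped_def yu)
    show "norm (snd (bounce_iter f d x0 v0 k) -
         (if even k then v (real k * d) else R (x (real k * d)) *v v (real k * d))) \<le> (B * (1 + M) + 1) * d\<^sup>2"
    proof (cases "even k")
      case True
      have "norm (snd ?z - snd ?\<zeta>) \<le> norm (?z - ?\<zeta>)"
        by (metis minus_prod_def norm_snd_le)
      then show ?thesis using bound B1 True by (simp add: unflipped_def yu)
    next
      case False
      \<comment> \<open>At an odd index a second reflection at the same position recovers the raw
        velocity.\<close>
      have "reflect ?z = u"
        using False by (simp add: unflipped_def yu reflect_def reflector_involution)
      moreover have "norm (reflect ?z - reflect ?\<zeta>) \<le> M * norm (?z - ?\<zeta>)"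
        using bound by (intro M(2)) auto
      ultimately show ?thesis using B2 False by (simp add: yu reflect_def)
    qed
  qed
qed

end

theorem theorem6:
  fixes f :: "real^'n \<Rightarrow> real^'m" and x0 v0 :: "real^'n" and tend :: real
  assumes "2 \<le> CARD('n)" and "0 < CARD('m)" and "CARD('m) < CARD('n)"
    and "smooth f"
    and "\<And>x. rank (jacobian f (at x)) = CARD('m)"
    and "0 \<le> tend"
  shows "\<exists>C>0. \<exists>\<delta>0>0. \<forall>x v. solves_limit_ode f x0 v0 tend x v \<longrightarrow>
           (\<forall>\<delta>. 0 < \<delta> \<and> \<delta> < \<delta>0 \<longrightarrow>
              pos_error f x0 v0 tend x \<delta> \<le> C * \<delta>\<^sup>2 \<and>
              vel_error f x0 v0 tend x v \<delta> \<le> C * \<delta>\<^sup>2)"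
proof -
  interpret full_rank_map f
    using assms by unfold_locales
  obtain C \<delta>0 where C: "C > 0" "\<delta>0 > 0"
    "\<And>x v d k. solves_limit_ode f x0 v0 tend x v \<Longrightarrow> 0 < d \<Longrightarrow> d < \<delta>0 \<Longrightarrow> real k * d \<le> tend \<Longrightarrow>
       norm (fst (bounce_iter f d x0 v0 k) - x (real k * d)) \<le> C * d\<^sup>2"
    "\<And>x v d k. solves_limit_ode f x0 v0 tend x v \<Longrightarrow> 0 < d \<Longrightarrow> d < \<delta>0 \<Longrightarrow> real k * d \<le> tend \<Longrightarrow>
       norm (snd (bounce_iter f d x0 v0 k) -
         (if even k then v (real k * d) else R (x (real k * d)) *v v (real k * d))) \<le> C * d\<^sup>2"
    using bounce_convergence[OF assms(6)] by blast
  have "pos_error f x0 v0 tend x d \<le> C * d\<^sup>2 \<and> vel_error f x0 v0 tend x v d \<le> C * d\<^sup>2"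
    if ode: "solves_limit_ode f x0 v0 tend x v" and d: "0 < d" "d < \<delta>0" for x v d
  proof -
    \<comment> \<open>Finiteness and nonemptiness reduce the bounds on the maxima to bounds for each
      index.\<close>
    have "{k. real k * d \<le> tend} \<subseteq> {..nat \<lceil>tend / d\<rceil>}"
    proof
      fix k assume "k \<in> {k. real k * d \<le> tend}"
      then have "real k \<le> tend / d" using d by (simp add: field_simps)
      then show "k \<in> {..nat \<lceil>tend / d\<rceil>}" by simp linarith
    qed
    then have fin: "finite {k. real k * d \<le> tend}" using finite_subset by blast
    have ne: "{k. real k * d \<le> tend} \<noteq> {}" using assms(6) by (auto intro!: exI[of _ 0])
    \<comment> \<open>With alternating sign on the normal part, even indices give
      \<open>T + N = I\<close> and odd ones \<open>T - N = R\<close>.\<close>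
    have flip: "proj_tangent f y *v u + (-1) ^ k *\<^sub>R (N y *v u) = (if even k then u else R y *v u)"
      for y u and k :: nat
      by (simp add: proj_tangent_mult reflector_mult scaleR_2)
    show ?thesis
      unfolding pos_error_def vel_error_def Let_def flip
      using C(3)[OF ode d] C(4)[OF ode d] fin ne by (auto simp: Max_le_iff)
  qed
  then show ?thesis using C(1,2) by blast
qed

end
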